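(* Assume that $S\colon U\to Y$ satisfies the following: (1) $u_i\rightharpoonup u$ in $U$ implies $S(u_i)\rightharpoonup S(u)$ in $Y$; (2) $S$ is Fréchet differentiable; (3) $S$ is compact; (4) there is a Banach space $V$ with $U\hookrightarrow V$ and $V^*\hookrightarrow L^\infty(\Omega;\mathbb R^m)$ such that $S'(u)^*$ maps $Y$ into $V^*$ for every $u\in U$ and, for every $u\in U$ and $y\in Y$, $\|[S'(\tilde u)-S'(u)]^*y\|_{V^*}\to0$ as $\tilde u\rightharpoonup u$ in $U$; (5) $S$ is linear. Then for any $z\in Y$ and any corresponding minimizer $\bar u\in U$ of $\mathcal E^z$, there exist a sequence $\{z_n\}_{n\in\mathbb N}\subset Y$ with $z_n\to z$ in $Y$ and corresponding minimizers $u_n\in U$ of $\mathcal E^{z_n}$ such that $u_n(x)\in\mathcal M$ for a.e. $x\in\Omega$, $u_n\rightharpoonup\bar u$ in $U$, and $\mathcal E^{z_n}(u_n)=\mathcal E^z(\bar u)$ for all $n$.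
   Context: $\Omega\subset\mathbb R^n$ is a bounded open domain, $m\ge 2$, $U=L^2(\Omega;\mathbb R^m)$ (identified with its dual), and $Y$ is a (real) Hilbert space. $\mathcal M\subset\mathbb R^m$ is a (nonempty) finite set, $\alpha>0$, $c\colon\mathbb R^m\to\mathbb R$ is non-negative, strictly convex, and lower semi-continuous, and $g=(\alpha c+\delta_{\mathcal M})^{**}$ (biconjugate, i.e. convex envelope), where $\delta_{\mathcal M}$ is $0$ on $\mathcal M$ and $\infty$ elsewhere. For $z\in Y$, $\mathcal E^z(u)=\frac12\|S(u)-z\|_Y^2+\int_\Omega g(u(x))\,\mathrm dx$, $u\in U$. $S'(u)^*\colon Y\to U$ is the Hilbert-space adjoint of the Fréchet derivative $S'(u)$ (for linear $S$, $S'(u)=S$). $\hookrightarrow$ denotes continuous embedding; $V^*$ is regarded as a subspace of $L^\infty(\Omega;\mathbb R^m)\subset U$ compatibly with the embedding $U\hookrightarrow V$, i.e., the pairing of $v^*\in V^*$ with $u\in U\hookrightarrow V$ is $\int_\Omega v^*\cdot u\,\mathrm dx$. Compactness of $S$ means that bounded sets are mapped to relatively compact sets; limits under weak convergence are understood for sequences. *)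

theory Defs
  imports "HOL-Analysis.Analysis"
begin

section \<open>The space of square integrable vector fields on \<open>\<Omega>\<close>\<close>

text \<open>
  Elements of $L^2(\Omega;\mathbb{R}^m)$ are represented by functions that are Lebesgue measurable
  and square integrable on \<open>\<Omega>\<close>; two such functions stand for the same element iff they agree
  almost everywhere on \<open>\<Omega>\<close>.  Maps defined on this space have to respect \<open>ae_eq\<close>.
\<close>

definition ae_eq :: "'a::euclidean_space set \<Rightarrow> ('a \<Rightarrow> 'b) \<Rightarrow> ('a \<Rightarrow> 'b) \<Rightarrow> bool" where
  "ae_eq \<Omega> u v \<longleftrightarrow> (AE x in lebesgue_on \<Omega>. u x = v x)"

definition L2 :: "'a::euclidean_space set \<Rightarrow> ('a \<Rightarrow> 'b::euclidean_space) set" where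
  "L2 \<Omega> = {u. u \<in> borel_measurable (lebesgue_on \<Omega>) \<and> integrable (lebesgue_on \<Omega>) (\<lambda>x. (norm (u x))\<^sup>2)}"

definition L2_inner ::
    "'a::euclidean_space set \<Rightarrow> ('a \<Rightarrow> 'b::euclidean_space) \<Rightarrow> ('a \<Rightarrow> 'b) \<Rightarrow> real" where
  "L2_inner \<Omega> u v = (\<integral>x. u x \<bullet> v x \<partial>lebesgue_on \<Omega>)"

definition L2_norm :: "'a::euclidean_space set \<Rightarrow> ('a \<Rightarrow> 'b::euclidean_space) \<Rightarrow> real" where
  "L2_norm \<Omega> u = sqrt (L2_inner \<Omega> u u)"

text \<open>Weak convergence of sequences, with the dual of the Hilbert space $L^2$ identified with
  $L^2$ itself.\<close>

definition L2_weakly_tendsto ::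
    "'a::euclidean_space set \<Rightarrow> (nat \<Rightarrow> 'a \<Rightarrow> 'b::euclidean_space) \<Rightarrow> ('a \<Rightarrow> 'b) \<Rightarrow> bool" where
  "L2_weakly_tendsto \<Omega> us u \<longleftrightarrow>
     (\<forall>i. us i \<in> L2 \<Omega>) \<and> u \<in> L2 \<Omega> \<and>
     (\<forall>\<phi>\<in>L2 \<Omega>. (\<lambda>i. L2_inner \<Omega> (us i) \<phi>) \<longlonglongrightarrow> L2_inner \<Omega> u \<phi>)"

definition weakly_tendsto :: "(nat \<Rightarrow> 'y::real_normed_vector) \<Rightarrow> 'y \<Rightarrow> bool" where
  "weakly_tendsto ys y \<longleftrightarrow> (\<forall>f::'y \<Rightarrow> real. bounded_linear f \<longrightarrow> (\<lambda>i. f (ys i)) \<longlonglongrightarrow> f y)"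

section \<open>Operators on \<open>L2 \<Omega>\<close>\<close>

definition L2_linear ::
    "'a::euclidean_space set \<Rightarrow> (('a \<Rightarrow> 'b::euclidean_space) \<Rightarrow> 'y::real_vector) \<Rightarrow> bool" where
  "L2_linear \<Omega> T \<longleftrightarrow>
     (\<forall>u\<in>L2 \<Omega>. \<forall>v\<in>L2 \<Omega>. T (\<lambda>x. u x + v x) = T u + T v) \<and>
     (\<forall>r. \<forall>u\<in>L2 \<Omega>. T (\<lambda>x. r *\<^sub>R u x) = r *\<^sub>R T u)"

definition L2_bounded_linear ::
    "'a::euclidean_space set \<Rightarrow> (('a \<Rightarrow> 'b::euclidean_space) \<Rightarrow> 'y::real_normed_vector) \<Rightarrow> bool" where
  "L2_bounded_linear \<Omega> T \<longleftrightarrow>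
     L2_linear \<Omega> T \<and> (\<exists>K. \<forall>u\<in>L2 \<Omega>. norm (T u) \<le> K * L2_norm \<Omega> u)"

definition L2_has_derivative ::
    "'a::euclidean_space set \<Rightarrow> (('a \<Rightarrow> 'b::euclidean_space) \<Rightarrow> 'y::real_normed_vector)
      \<Rightarrow> (('a \<Rightarrow> 'b) \<Rightarrow> 'y) \<Rightarrow> ('a \<Rightarrow> 'b) \<Rightarrow> bool" where
  "L2_has_derivative \<Omega> S D u \<longleftrightarrow>
     L2_bounded_linear \<Omega> D \<and>
     (\<forall>e>0. \<exists>d>0. \<forall>h\<in>L2 \<Omega>. L2_norm \<Omega> h < d \<longrightarrow>
        norm (S (\<lambda>x. u x + h x) - S u - D h) \<le> e * L2_norm \<Omega> h)"

text \<open>\<open>L2_adjoint_at \<Omega> D y f\<close> says that \<open>f\<close> represents $D^*y$, where $D^*$ is the Hilbert space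
  adjoint of \<open>D\<close>; such an \<open>f\<close> is unique up to \<open>ae_eq\<close>.\<close>

definition L2_adjoint_at ::
    "'a::euclidean_space set \<Rightarrow> (('a \<Rightarrow> 'b::euclidean_space) \<Rightarrow> 'y::real_inner)
      \<Rightarrow> 'y \<Rightarrow> ('a \<Rightarrow> 'b) \<Rightarrow> bool" where
  "L2_adjoint_at \<Omega> D y f \<longleftrightarrow> f \<in> L2 \<Omega> \<and> (\<forall>h\<in>L2 \<Omega>. D h \<bullet> y = L2_inner \<Omega> h f)"

definition L2_compact_operator ::
    "'a::euclidean_space set \<Rightarrow> (('a \<Rightarrow> 'b::euclidean_space) \<Rightarrow> 'y::real_normed_vector) \<Rightarrow> bool" where
  "L2_compact_operator \<Omega> S \<longleftrightarrow>
     (\<forall>B\<subseteq>L2 \<Omega>. (\<exists>K. \<forall>u\<in>B. L2_norm \<Omega> u \<le> K) \<longrightarrow> compact (closure (S ` B)))"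

section \<open>Continuous embeddings\<close>

definition L2_embedding ::
    "'a::euclidean_space set \<Rightarrow> (('a \<Rightarrow> 'b::euclidean_space) \<Rightarrow> 'v::real_normed_vector) \<Rightarrow> bool" where
  "L2_embedding \<Omega> \<iota> \<longleftrightarrow>
     L2_bounded_linear \<Omega> \<iota> \<and> (\<forall>u\<in>L2 \<Omega>. \<forall>v\<in>L2 \<Omega>. \<iota> u = \<iota> v \<longrightarrow> ae_eq \<Omega> u v)"

text \<open>A continuous embedding into $L^\infty(\Omega)$; the bound with constant \<open>K\<close> says that \<open>J w\<close>
  is essentially bounded with essential supremum norm at most \<open>K * norm w\<close>.\<close>

definition Linfty_embedding ::
    "'a::euclidean_space set \<Rightarrow> ('w::real_normed_vector \<Rightarrow> 'a \<Rightarrow> 'b::euclidean_space) \<Rightarrow> bool" where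
  "Linfty_embedding \<Omega> J \<longleftrightarrow>
     (\<forall>w. J w \<in> borel_measurable (lebesgue_on \<Omega>)) \<and>
     (\<forall>w w'. ae_eq \<Omega> (J (w + w')) (\<lambda>x. J w x + J w' x)) \<and>
     (\<forall>r w. ae_eq \<Omega> (J (r *\<^sub>R w)) (\<lambda>x. r *\<^sub>R J w x)) \<and>
     (\<exists>K. \<forall>w. AE x in lebesgue_on \<Omega>. norm (J w x) \<le> K * norm w) \<and>
     (\<forall>w w'. ae_eq \<Omega> (J w) (J w') \<longrightarrow> w = w')"

section \<open>The regularizer and the energy\<close>

definition strictly_convex :: "('b::real_vector \<Rightarrow> real) \<Rightarrow> bool" where
  "strictly_convex c \<longleftrightarrow>
     (\<forall>x y t. x \<noteq> y \<longrightarrow> 0 < t \<longrightarrow> t < 1 \<longrightarrow>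
        c ((1 - t) *\<^sub>R x + t *\<^sub>R y) < (1 - t) * c x + t * c y)"

definition lower_semicont :: "('b::topological_space \<Rightarrow> real) \<Rightarrow> bool" where
  "lower_semicont c \<longleftrightarrow> (\<forall>x. ereal (c x) \<le> Liminf (at x) (\<lambda>y. ereal (c y)))"

definition fenchel_conjugate :: "('b::real_inner \<Rightarrow> ereal) \<Rightarrow> 'b \<Rightarrow> ereal" where
  "fenchel_conjugate f p = (SUP v. ereal (p \<bullet> v) - f v)"

definition convex_indicator :: "'b set \<Rightarrow> 'b \<Rightarrow> ereal" where
  "convex_indicator M v = (if v \<in> M then 0 else \<infinity>)"

definition regularizer :: "real \<Rightarrow> ('b::real_inner \<Rightarrow> real) \<Rightarrow> 'b set \<Rightarrow> 'b \<Rightarrow> ereal" where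
  "regularizer \<alpha> c M =
     fenchel_conjugate (fenchel_conjugate (\<lambda>v. ereal (\<alpha> * c v) + convex_indicator M v))"

text \<open>For $\alpha c\ge 0$ the regularizer is nonnegative, so it may be integrated as an
  \<open>ennreal\<close>-valued function.\<close>

lemma regularizer_nonneg:
  assumes "\<alpha> \<ge> 0" "\<And>v. c v \<ge> 0"
  shows "regularizer \<alpha> c M v \<ge> 0"
proof -
  let ?f = "\<lambda>v. ereal (\<alpha> * c v) + convex_indicator M v"
  have "fenchel_conjugate ?f 0 \<le> 0"
    unfolding fenchel_conjugate_def
    by (rule SUP_least) (use assms in \<open>auto simp: convex_indicator_def\<close>)
  hence "0 \<le> ereal (v \<bullet> 0) - fenchel_conjugate ?f 0"
    by (simp add: ereal_diff_positive flip: zero_ereal_def)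
  also have "\<dots> \<le> regularizer \<alpha> c M v"
    unfolding regularizer_def fenchel_conjugate_def[of "fenchel_conjugate ?f"]
    by (rule SUP_upper) simp
  finally show ?thesis .
qed

definition energy ::
    "'a::euclidean_space set \<Rightarrow> real \<Rightarrow> ('b::euclidean_space \<Rightarrow> real) \<Rightarrow> 'b set
      \<Rightarrow> (('a \<Rightarrow> 'b) \<Rightarrow> 'y::real_normed_vector) \<Rightarrow> 'y \<Rightarrow> ('a \<Rightarrow> 'b) \<Rightarrow> ennreal" where
  "energy \<Omega> \<alpha> c M S z u =
     ennreal ((norm (S u - z))\<^sup>2 / 2) + (\<integral>\<^sup>+x. e2ennreal (regularizer \<alpha> c M (u x)) \<partial>lebesgue_on \<Omega>)"

definition L2_minimizer ::
    "'a::euclidean_space set \<Rightarrow> (('a \<Rightarrow> 'b::euclidean_space) \<Rightarrow> ennreal) \<Rightarrow> ('a \<Rightarrow> 'b) \<Rightarrow> bool" where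
  "L2_minimizer \<Omega> E u \<longleftrightarrow> u \<in> L2 \<Omega> \<and> (\<forall>v\<in>L2 \<Omega>. E u \<le> E v)"

end

theory Submission
  imports Defs
begin

text \<open>
  The energy is convex and the operator is linear, so minimality of \<open>u\<close> is equivalent to a
  pointwise condition on the dual field \<open>p\<close> which the adjoint of \<open>S\<close> assigns to the residual
  \<open>z - S u\<close>: for almost every \<open>x\<close>, the vector \<open>p x\<close> is a subgradient of the regularizer at
  \<open>u x\<close> (\<open>minimizer_on_faces\<close>, \<open>minimizer_if_on_faces\<close>). The regularizer is the convex
  envelope of a function on the finite set \<open>M\<close>; hence it is polyhedral, and the points where
  \<open>p x\<close> is a subgradient form the convex hull of the active points of \<open>p x\<close>, those members of
  \<open>M\<close> where the tilted function is minimal (\<open>regularizer_eq_on_face\<close>,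
  \<open>in_face_if_regularizer_eq\<close>). The condition survives if \<open>u x\<close> is replaced by any active
  point of \<open>p x\<close>, as long as \<open>p\<close> does not change.

  This leaves room to make a minimizer take its values in \<open>M\<close>. Divide \<open>\<Omega>\<close> into small cells on
  which the set of active points is constant. The mean of the minimizer over a cell is a convex
  combination of active points, and since Lebesgue measure has no atoms the cell can be cut into
  pieces that carry these points with the right weights. The result has the same cell integrals
  (\<open>cellwise_rearrangement_in_faces\<close>), so for ever smaller cells it converges weakly to the
  given minimizer (\<open>L2_weakly_tendsto_if_cell_integrals_eq\<close>).

  Shifting the data by the change \<open>S u_k - S u\<close> of the state keeps the residual, hence \<open>p\<close>, so
  the rearranged field \<open>u_k\<close> is a minimizer for the shifted data. The shift tends to zero
  because \<open>S\<close> is compact and weakly continuous (\<open>weak_limit_in_compact\<close>). The tracking term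
  is unchanged, and on every cell the regularizer is affine on the common face, so its integral
  is determined by the cell integrals of the field: the energies agree exactly
  (\<open>energy_on_faces\<close>).
\<close>

section \<open>Convex duality for a function on finitely many points\<close>

text \<open>
  The Fenchel conjugate of the function that equals \<open>b\<close> on \<open>M\<close> and infinity elsewhere.
\<close>

definition finite_conjugate :: "('b::real_inner \<Rightarrow> real) \<Rightarrow> 'b set \<Rightarrow> 'b \<Rightarrow> real" where
  "finite_conjugate b M q = Max ((\<lambda>v. q \<bullet> v - b v) ` M)"

text \<open>
  Geometrically, the affine function of slope \<open>q\<close> that touches the graph of \<open>b\<close> over \<open>M\<close> from
  below touches it exactly at these points.
\<close>

definition active_points :: "('b::real_inner \<Rightarrow> real) \<Rightarrow> 'b set \<Rightarrow> 'b \<Rightarrow> 'b set" where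
  "active_points b M q = {v \<in> M. q \<bullet> v - b v = finite_conjugate b M q}"

lemma finite_conjugate_ge:
  assumes "finite M" "v \<in> M"
  shows "q \<bullet> v - b v \<le> finite_conjugate b M q"
  unfolding finite_conjugate_def using assms by (intro Max_ge) auto

lemma active_points_subset: "active_points b M q \<subseteq> M"
  by (auto simp: active_points_def)

lemma active_points_nonempty:
  assumes "finite M" "M \<noteq> {}"
  shows "active_points b M q \<noteq> {}"
proof -
  have "finite_conjugate b M q \<in> (\<lambda>v. q \<bullet> v - b v) ` M"
    unfolding finite_conjugate_def using assms by (intro Max_in) auto
  then show ?thesis by (auto simp: active_points_def)
qed

lemma borel_measurable_finite_conjugate:
  fixes M :: "'b::euclidean_space set"
  assumes "finite M" "M \<noteq> {}"
  shows "finite_conjugate b M \<in> borel_measurable borel"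
proof -
  have "(\<lambda>q. Max ((\<lambda>v. q \<bullet> v - b v) ` M)) \<in> borel_measurable borel"
    using assms(1) by (intro borel_measurable_Max) auto
  then show ?thesis by (simp add: finite_conjugate_def[abs_def])
qed

lemma regularizer_eq_SUP:
  assumes "finite M" "M \<noteq> {}"
  shows "regularizer \<alpha> c M v = (SUP q. ereal (q \<bullet> v - finite_conjugate (\<lambda>v. \<alpha> * c v) M q))"
proof -
  have conj: "fenchel_conjugate (\<lambda>v. ereal (\<alpha> * c v) + convex_indicator M v) q
      = ereal (finite_conjugate (\<lambda>v. \<alpha> * c v) M q)" for q
    unfolding fenchel_conjugate_def
  proof (rule antisym)
    show "(SUP v. ereal (q \<bullet> v) - (ereal (\<alpha> * c v) + convex_indicator M v))
      \<le> ereal (finite_conjugate (\<lambda>v. \<alpha> * c v) M q)"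
      using finite_conjugate_ge[OF assms(1), of _ q "\<lambda>v. \<alpha> * c v"]
      by (intro SUP_least) (auto simp: convex_indicator_def)
    obtain v where "v \<in> M" "q \<bullet> v - \<alpha> * c v = finite_conjugate (\<lambda>v. \<alpha> * c v) M q"
      using active_points_nonempty[OF assms, of "\<lambda>v. \<alpha> * c v" q] by (auto simp: active_points_def)
    then show "ereal (finite_conjugate (\<lambda>v. \<alpha> * c v) M q)
      \<le> (SUP v. ereal (q \<bullet> v) - (ereal (\<alpha> * c v) + convex_indicator M v))"
      by (intro SUP_upper2[of v]) (auto simp: convex_indicator_def)
  qed
  show ?thesis
    unfolding regularizer_def fenchel_conjugate_def[of "fenchel_conjugate _"] conj
    by (simp add: inner_commute)
qed

lemma regularizer_ge:
  assumes "finite M" "M \<noteq> {}"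
  shows "ereal (q \<bullet> v - finite_conjugate (\<lambda>v. \<alpha> * c v) M q) \<le> regularizer \<alpha> c M v"
  unfolding regularizer_eq_SUP[OF assms] by (intro SUP_upper) simp

lemma regularizer_le_iff:
  assumes "finite M" "M \<noteq> {}"
  shows "regularizer \<alpha> c M v \<le> ereal r
    \<longleftrightarrow> (\<forall>q. q \<bullet> v - finite_conjugate (\<lambda>v. \<alpha> * c v) M q \<le> r)"
  unfolding regularizer_eq_SUP[OF assms] by (simp add: SUP_le_iff)

lemma regularizer_convex:
  assumes "finite M" "M \<noteq> {}" "0 \<le> t" "t \<le> 1"
    and "regularizer \<alpha> c M v \<le> ereal r" "regularizer \<alpha> c M w \<le> ereal s"
  shows "regularizer \<alpha> c M ((1 - t) *\<^sub>R v + t *\<^sub>R w) \<le> ereal ((1 - t) * r + t * s)"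
  unfolding regularizer_le_iff[OF assms(1,2)]
proof
  fix q
  let ?k = "finite_conjugate (\<lambda>v. \<alpha> * c v) M q"
  have "(1 - t) * (q \<bullet> v - ?k) + t * (q \<bullet> w - ?k) \<le> (1 - t) * r + t * s"
    using assms unfolding regularizer_le_iff[OF assms(1,2)]
    by (intro add_mono mult_left_mono) auto
  then show "q \<bullet> ((1 - t) *\<^sub>R v + t *\<^sub>R w) - ?k \<le> (1 - t) * r + t * s"
    by (simp add: algebra_simps inner_add_right inner_diff_right)
qed

text \<open>
  As a supremum of affine functions the envelope is lower semicontinuous, even where it is
  infinite.
\<close>

lemma borel_measurable_regularizer:
  fixes M :: "'b::euclidean_space set"
  assumes "finite M" "M \<noteq> {}"
  shows "regularizer \<alpha> c M \<in> borel_measurable borel"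
proof (rule borel_measurableI_greater)
  fix y
  have "{v \<in> space borel. y < regularizer \<alpha> c M v}
    = (\<Union>q. {v. y < ereal (q \<bullet> v - finite_conjugate (\<lambda>v. \<alpha> * c v) M q)})"
    unfolding regularizer_eq_SUP[OF assms] by (auto simp: less_SUP_iff)
  also have "open \<dots>"
    by (intro open_UN ballI open_Collect_less continuous_intros)
  finally show "{v \<in> space borel. y < regularizer \<alpha> c M v} \<in> sets borel"
    by auto
qed

text \<open>
  Equality in the Fenchel-Young inequality says that \<open>q\<close> is a subgradient of the envelope at \<open>v\<close>.
  This holds exactly if \<open>v\<close> lies in the face spanned by the active points of \<open>q\<close>, and both
  directions matter: every minimizer has to live in such faces, and every field that lives in
  them is a minimizer. In the direction below, each affine minorant of \<open>b\<close> on \<open>M\<close> is, at an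
  active point, dominated by the one of slope \<open>q\<close>; averaging over the active points gives the
  claim. In particular the envelope is affine on the face.
\<close>

lemma regularizer_eq_on_face:
  assumes "finite M" "M \<noteq> {}" "v \<in> convex hull (active_points (\<lambda>v. \<alpha> * c v) M q)"
  shows "regularizer \<alpha> c M v = ereal (q \<bullet> v - finite_conjugate (\<lambda>v. \<alpha> * c v) M q)"
proof (rule antisym[OF _ regularizer_ge[OF assms(1,2)]])
  let ?F = "active_points (\<lambda>v. \<alpha> * c v) M q" and ?k = "finite_conjugate (\<lambda>v. \<alpha> * c v) M"
  have fin: "finite ?F"
    using finite_subset[OF active_points_subset assms(1)] .
  obtain \<theta> where \<theta>: "\<And>m. m \<in> ?F \<Longrightarrow> 0 \<le> \<theta> m" "sum \<theta> ?F = 1" "v = (\<Sum>m\<in>?F. \<theta> m *\<^sub>R m)"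
    using assms(3) unfolding convex_hull_finite[OF fin] by auto
  have affine: "q' \<bullet> v - k = (\<Sum>m\<in>?F. \<theta> m * (q' \<bullet> m - k))" for q' k
    using \<theta>(2) by (simp add: \<theta>(3) inner_sum_right right_diff_distrib sum_subtractf
        flip: sum_distrib_right)
  show "regularizer \<alpha> c M v \<le> ereal (q \<bullet> v - ?k q)"
    unfolding regularizer_le_iff[OF assms(1,2)] affine
  proof (intro allI sum_mono mult_left_mono)
    fix q' m assume m: "m \<in> ?F"
    then show "0 \<le> \<theta> m" by (rule \<theta>(1))
    show "q' \<bullet> m - ?k q' \<le> q \<bullet> m - ?k q"
      using m finite_conjugate_ge[OF assms(1), of m q' "\<lambda>v. \<alpha> * c v"]
      by (auto simp: active_points_def)
  qed
qed

text \<open>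
  For a small perturbation of the slope the maximum that defines the conjugate is still attained
  only at points that were active before, so that the directional derivative of the conjugate
  is governed by the active points alone.
\<close>

lemma finite_conjugate_perturb:
  fixes M :: "'b::real_inner set"
  assumes "finite M" "M \<noteq> {}" "\<And>m. m \<in> active_points b M q \<Longrightarrow> d \<bullet> m < r"
  obtains t where "t > 0" "finite_conjugate b M (q + t *\<^sub>R d) < finite_conjugate b M q + t * r"
proof -
  have ev: "\<forall>\<^sub>F t in at_right 0. (q + t *\<^sub>R d) \<bullet> m - b m < finite_conjugate b M q + t * r"
    if "m \<in> M" for m
  proof (cases "m \<in> active_points b M q")
    case True
    have "\<forall>\<^sub>F t::real in at_right 0. 0 < t"
      by (rule eventually_at_right_less)
    then show ?thesis
    proof eventually_elim
      case (elim t)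
      then have "t * (d \<bullet> m) < t * r" using assms(3)[OF True] by simp
      then show ?case using True by (auto simp: active_points_def inner_add_left)
    qed
  next
    case False
    then have less: "q \<bullet> m - b m < finite_conjugate b M q"
      using finite_conjugate_ge[OF assms(1) that, of q b] that by (auto simp: active_points_def)
    have "((\<lambda>t. (finite_conjugate b M q + t * r) - ((q + t *\<^sub>R d) \<bullet> m - b m))
        \<longlongrightarrow> (finite_conjugate b M q + 0 * r) - ((q + 0 *\<^sub>R d) \<bullet> m - b m)) (at_right 0)"
      by (intro tendsto_intros)
    then have "\<forall>\<^sub>F t in at_right 0.
        0 < (finite_conjugate b M q + t * r) - ((q + t *\<^sub>R d) \<bullet> m - b m)"
      using less by (intro order_tendstoD(1)) auto
    then show ?thesis by eventually_elim simp
  qed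
  have "\<forall>\<^sub>F t::real in at_right 0. 0 < t
      \<and> (\<forall>m\<in>M. (q + t *\<^sub>R d) \<bullet> m - b m < finite_conjugate b M q + t * r)"
    using ev assms(1) by (intro eventually_conj eventually_at_right_less eventually_ball_finite) auto
  then obtain t :: real where "0 < t"
      "\<forall>m\<in>M. (q + t *\<^sub>R d) \<bullet> m - b m < finite_conjugate b M q + t * r"
    using eventually_happens'[OF trivial_limit_at_right_real] by blast
  then show thesis
    using assms(1,2) by (intro that[of t]) (auto simp: finite_conjugate_def[of b M "q + t *\<^sub>R d"])
qed

text \<open>
  Tilting \<open>q\<close> in a direction that separates \<open>v\<close> from the face would yield an affine
  minorant that beats the supposed value of the envelope at \<open>v\<close>.
\<close>

lemma in_face_if_regularizer_eq:
  fixes M :: "'b::euclidean_space set"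
  assumes "finite M" "M \<noteq> {}"
    and eq: "regularizer \<alpha> c M v = ereal (q \<bullet> v - finite_conjugate (\<lambda>v. \<alpha> * c v) M q)"
  shows "v \<in> convex hull (active_points (\<lambda>v. \<alpha> * c v) M q)"
proof (rule ccontr)
  let ?b = "\<lambda>v. \<alpha> * c v"
  let ?F = "active_points ?b M q"
  assume "v \<notin> convex hull ?F"
  moreover have "closed (convex hull ?F)"
    using finite_subset[OF active_points_subset assms(1)]
    by (intro compact_imp_closed compact_convex_hull finite_imp_compact)
  ultimately obtain d r where d: "d \<bullet> v < r" "\<And>m. m \<in> convex hull ?F \<Longrightarrow> r < d \<bullet> m"
    using separating_hyperplane_closed_point[of "convex hull ?F" v] by auto
  have "(- d) \<bullet> m < - r" if "m \<in> ?F" for m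
    using d(2)[OF hull_inc[OF that]] by simp
  then obtain t where t: "t > 0"
      "finite_conjugate ?b M (q + t *\<^sub>R (- d)) < finite_conjugate ?b M q + t * (- r)"
    by (rule finite_conjugate_perturb[OF assms(1,2)])
  have "(q + t *\<^sub>R (- d)) \<bullet> v - finite_conjugate ?b M (q + t *\<^sub>R (- d)) \<le> q \<bullet> v - finite_conjugate ?b M q"
    using regularizer_ge[OF assms(1,2), where q = "q + t *\<^sub>R (- d)" and \<alpha> = \<alpha> and c = c and v = v] by (simp add: eq)
  moreover have "t * (d \<bullet> v) < t * r" using d(1) t(1) by simp
  ultimately show False using t(2) by (simp add: inner_diff_left)
qed

section \<open>Rearranging a function inside a cell\<close>

text \<open>
  Lebesgue measure has no atoms: sweeping a hyperplane across \<open>A\<close>, the measure of the part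
  already passed grows continuously, because thin slabs of a box have small measure.
\<close>

lemma ex_subset_of_measure:
  fixes A :: "'a::euclidean_space set"
  assumes A: "A \<in> sets lebesgue" "bounded A" and r: "0 \<le> r" "r \<le> measure lebesgue A"
  obtains B where "B \<subseteq> A" "B \<in> sets lebesgue" "measure lebesgue B = r"
proof -
  obtain i :: 'a where i: "i \<in> Basis" using nonempty_Basis by blast
  obtain R where R: "0 < R" "\<And>x. x \<in> A \<Longrightarrow> norm x \<le> R" using A(2) by (auto simp: bounded_pos)
  obtain a where a: "A \<subseteq> cbox (- a) a" using bounded_subset_cbox_symmetric[OF A(2)] by blast
  let ?H = "\<lambda>t. A \<inter> {x. x \<bullet> i \<le> t}"
  have H: "?H t \<in> lmeasurable" for t
    using A by (intro bounded_set_imp_lmeasurable sets.Int) (auto intro: bounded_subset)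
  have "isCont (\<lambda>t. measure lebesgue (?H t)) t" for t
    unfolding isCont_def LIM_eq
  proof (intro allI impI)
    fix e :: real assume "0 < e"
    then obtain d where d: "0 < d"
        "measure lborel (cbox (- a) a \<inter> {x. \<bar>x \<bullet> i - t\<bar> \<le> d}) < e"
      using content_doublesplit[OF _ i] by metis
    let ?S = "cbox (- a) a \<inter> {x. \<bar>x \<bullet> i - t\<bar> \<le> d}"
    have S: "?S \<in> lmeasurable"
    proof (intro bounded_set_imp_lmeasurable)
      show "bounded ?S" by (rule bounded_subset[OF bounded_cbox]) auto
      have "closed ?S" by (intro closed_Int closed_cbox closed_Collect_le continuous_intros)
      then show "?S \<in> sets lebesgue" by auto
    qed
    have S_small: "measure lebesgue ?S < e"
      using d(2) S by (simp add: measure_completion fmeasurable_def)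
    have step: "measure lebesgue (?H s) \<le> measure lebesgue (?H s') + measure lebesgue ?S"
      if "\<bar>s - t\<bar> \<le> d" "\<bar>s' - t\<bar> \<le> d" for s s'
    proof -
      have "?H s \<subseteq> ?H s' \<union> ?S" using that a by auto
      then have "measure lebesgue (?H s) \<le> measure lebesgue (?H s' \<union> ?S)"
        using H S by (intro measure_mono_fmeasurable) (auto dest: fmeasurableD)
      also have "\<dots> \<le> measure lebesgue (?H s') + measure lebesgue ?S"
        using H S by (intro measure_Un_le) (auto dest: fmeasurableD)
      finally show ?thesis .
    qed
    have "\<forall>s. s \<noteq> t \<and> norm (s - t) < d \<longrightarrow>
        norm (measure lebesgue (?H s) - measure lebesgue (?H t)) < e"
    proof (intro allI impI)
      fix s assume "s \<noteq> t \<and> norm (s - t) < d"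
      then have "\<bar>s - t\<bar> \<le> d" by simp
      then show "norm (measure lebesgue (?H s) - measure lebesgue (?H t)) < e"
        using step[of s t] step[of t s] S_small d(1) by simp
    qed
    then show "\<exists>d>0. \<forall>s. s \<noteq> t \<and> norm (s - t) < d \<longrightarrow>
        norm (measure lebesgue (?H s) - measure lebesgue (?H t)) < e"
      using d(1) by blast
  qed
  then have cont: "continuous_on {- R - 1..R} (\<lambda>t. measure lebesgue (?H t))"
    by (simp add: continuous_at_imp_continuous_on)
  have coord: "\<bar>x \<bullet> i\<bar> \<le> R" if "x \<in> A" for x
    using Basis_le_norm[OF i, of x] R(2)[OF that] by linarith
  have "?H (- R - 1) = {}" "?H R = A" using coord by (force simp: abs_le_iff)+
  then have "measure lebesgue (?H (- R - 1)) \<le> r" "r \<le> measure lebesgue (?H R)"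
    using r by auto
  then obtain t where "measure lebesgue (?H t) = r"
    using IVT'[OF _ _ _ cont] R(1) by auto
  then show thesis
    using that[of "?H t"] fmeasurableD[OF H] by blast
qed

lemma set_integrable_finite_range:
  fixes w :: "'a::euclidean_space \<Rightarrow> 'b::euclidean_space"
  assumes "w \<in> borel_measurable lebesgue" "A \<in> lmeasurable" "finite F" "\<And>x. x \<in> A \<Longrightarrow> w x \<in> F"
  shows "set_integrable lebesgue A w"
proof -
  obtain B where "\<And>v. v \<in> F \<Longrightarrow> norm v \<le> B"
    using finite_imp_bounded[OF assms(3)] by (auto simp: bounded_iff)
  then show ?thesis
    unfolding set_integrable_def
    using assms by (intro integrableI_bounded_set_indicator[where B=B]) (auto simp: fmeasurable_def)
qed

lemma set_integral_const:
  fixes m :: "'b::euclidean_space"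
  assumes "A \<in> fmeasurable M"
  shows "(LINT x:A|M. m) = measure M A *\<^sub>R m"
  using assms unfolding set_lebesgue_integral_def fmeasurable_def
  by (subst Bochner_Integration.integral_scaleR_left) (auto simp: top.not_eq_extremum)

text \<open>
  The set is cut into pieces of the prescribed measures \<open>a m\<close>, one after the other, and each
  piece is given the value \<open>m\<close>.
\<close>

lemma finite_valued_with_integral:
  fixes A :: "'a::euclidean_space set" and F :: "'b::euclidean_space set"
  assumes "finite F" "F \<noteq> {}" "A \<in> sets lebesgue" "bounded A"
    and "\<And>m. m \<in> F \<Longrightarrow> 0 \<le> a m" "sum a F = measure lebesgue A"
  shows "\<exists>w \<in> borel_measurable lebesgue. (\<forall>x\<in>A. w x \<in> F)
    \<and> (LINT x:A|lebesgue. w x) = (\<Sum>m\<in>F. a m *\<^sub>R m)"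
  using assms
proof (induction F arbitrary: A rule: finite_ne_induct)
  case (singleton m)
  then show ?case
    by (intro bexI[of _ "\<lambda>_. m"]) (auto simp: set_integral_const bounded_set_imp_lmeasurable)
next
  case (insert m F)
  have "a m \<le> measure lebesgue A"
    using insert by (simp add: sum_nonneg flip: insert.prems(4))
  then obtain B where B: "B \<subseteq> A" "B \<in> sets lebesgue" "measure lebesgue B = a m"
    using ex_subset_of_measure[of A "a m"] insert.prems by auto
  have lm: "B \<in> lmeasurable" "A - B \<in> lmeasurable" "A \<in> lmeasurable"
    using B insert.prems by (auto intro!: bounded_set_imp_lmeasurable intro: bounded_subset)
  have "sum a F = measure lebesgue (A - B)"
    using insert B lm by (simp add: measurable_measure_Diff)
  then obtain w where w: "w \<in> borel_measurable lebesgue" "\<And>x. x \<in> A - B \<Longrightarrow> w x \<in> F"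
      "(LINT x:A - B|lebesgue. w x) = (\<Sum>m\<in>F. a m *\<^sub>R m)"
    using insert.IH[of "A - B"] insert.prems lm by (auto dest: fmeasurableD intro: bounded_subset)
  define w' where "w' x = (if x \<in> B then m else w x)" for x
  have w'_meas: "w' \<in> borel_measurable lebesgue"
    unfolding w'_def[abs_def] using w(1) B(2) by (intro measurable_If_set) auto
  have "(LINT x:B \<union> (A - B)|lebesgue. w' x)
      = (LINT x:B|lebesgue. w' x) + (LINT x:A - B|lebesgue. w' x)"
    using w w'_meas lm insert.hyps(1)
    by (intro set_integral_Un set_integrable_finite_range[where F="insert m F"]) (auto simp: w'_def)
  also have "(LINT x:A - B|lebesgue. w' x) = (\<Sum>m\<in>F. a m *\<^sub>R m)"
    unfolding w(3)[symmetric] using lm by (intro set_lebesgue_integral_cong) (auto simp: w'_def)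
  also have "(LINT x:B|lebesgue. w' x) = (LINT x:B|lebesgue. m)"
    using lm by (intro set_lebesgue_integral_cong) (auto simp: w'_def)
  also have "\<dots> = a m *\<^sub>R m"
    using lm B(3) by (simp add: set_integral_const)
  finally show ?case
    using w'_meas w(2) B(1) insert.hyps by (intro bexI[of _ w']) (auto simp: w'_def Un_absorb1)
qed

lemma mean_value_in_closed_convex:
  fixes u :: "'a \<Rightarrow> 'b::euclidean_space"
  assumes "A \<in> fmeasurable M" "0 < measure M A" "convex C" "closed C"
    and u: "set_integrable M A u" "AE x\<in>A in M. u x \<in> C"
  shows "(1 / measure M A) *\<^sub>R (LINT x:A|M. u x) \<in> C"
proof (rule ccontr)
  let ?v = "(1 / measure M A) *\<^sub>R (LINT x:A|M. u x)"
  assume "?v \<notin> C"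
  then obtain d r where d: "d \<bullet> ?v < r" "\<And>y. y \<in> C \<Longrightarrow> r < d \<bullet> y"
    using separating_hyperplane_closed_point[OF assms(3,4)] by blast
  have int: "integrable M (\<lambda>x. indicator A x *\<^sub>R u x)"
    using u(1) by (simp add: set_integrable_def)
  have "r * measure M A = (LINT x:A|M. r)"
    using assms(1) by (simp add: set_integral_const)
  also have "\<dots> \<le> (LINT x|M. d \<bullet> (indicator A x *\<^sub>R u x))"
    unfolding set_lebesgue_integral_def
  proof (intro integral_mono_AE)
    show "integrable M (\<lambda>x. indicator A x *\<^sub>R r)"
      using assms(1) by (auto simp: fmeasurable_def top.not_eq_extremum)
    show "AE x in M. indicator A x *\<^sub>R r \<le> d \<bullet> (indicator A x *\<^sub>R u x)"
      using u(2) by eventually_elim (auto simp: indicator_def dest!: d(2))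
    show "integrable M (\<lambda>x. d \<bullet> (indicator A x *\<^sub>R u x))"
      by (rule integrable_inner_right[OF int])
  qed
  also have "\<dots> = d \<bullet> (LINT x:A|M. u x)"
    unfolding set_lebesgue_integral_def by (rule integral_inner_right[OF int])
  finally have "r \<le> d \<bullet> ?v"
    using assms(2) by (simp add: field_simps)
  with d(1) show False by simp
qed

text \<open>
  The mean value of \<open>u\<close> is one fixed convex combination of the points of \<open>F\<close>, and its
  weights tell how much of the cell each point has to occupy. Working with the mean value avoids
  choosing weights for \<open>u x\<close> measurably in \<open>x\<close>.
\<close>

lemma rearrangement_on_cell:
  fixes A :: "'a::euclidean_space set" and u :: "'a \<Rightarrow> 'b::euclidean_space"
  assumes A: "A \<in> sets lebesgue" "bounded A" and F: "finite F" "F \<noteq> {}"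
    and u: "set_integrable lebesgue A u" "AE x\<in>A in lebesgue. u x \<in> convex hull F"
  shows "\<exists>w \<in> borel_measurable lebesgue. (\<forall>x\<in>A. w x \<in> F)
    \<and> (LINT x:A|lebesgue. w x) = (LINT x:A|lebesgue. u x)"
proof (cases "measure lebesgue A = 0")
  case True
  have lm: "A \<in> lmeasurable" using A by (intro bounded_set_imp_lmeasurable)
  then have "A \<in> null_sets lebesgue"
    using True by (simp add: negligible_iff_measure flip: negligible_iff_null_sets)
  then have "AE x in lebesgue. x \<notin> A" by (rule AE_not_in)
  then have "(LINT x:A|lebesgue. v x) = 0" for v :: "'a \<Rightarrow> 'b"
    unfolding set_lebesgue_integral_def
    by (intro integral_eq_zero_AE) (auto elim!: eventually_mono)
  moreover obtain m where "m \<in> F" using F(2) by blast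
  ultimately show ?thesis by (intro bexI[of _ "\<lambda>_. m"]) auto
next
  case False
  then have pos: "0 < measure lebesgue A" by (simp add: zero_less_measure_iff)
  let ?mean = "(1 / measure lebesgue A) *\<^sub>R (LINT x:A|lebesgue. u x)"
  have "?mean \<in> convex hull F"
    using A F pos u by (intro mean_value_in_closed_convex bounded_set_imp_lmeasurable
        compact_imp_closed compact_convex_hull finite_imp_compact) auto
  then obtain \<theta> where \<theta>: "\<And>m. m \<in> F \<Longrightarrow> 0 \<le> \<theta> m" "sum \<theta> F = 1"
      "(\<Sum>m\<in>F. \<theta> m *\<^sub>R m) = ?mean"
    unfolding convex_hull_finite[OF F(1)] by auto
  have "(\<Sum>m\<in>F. (measure lebesgue A * \<theta> m) *\<^sub>R m) = measure lebesgue A *\<^sub>R ?mean"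
    by (simp add: scaleR_sum_right flip: \<theta>(3))
  also have "\<dots> = (LINT x:A|lebesgue. u x)" using pos by simp
  finally show ?thesis
    using finite_valued_with_integral[OF F A, of "\<lambda>m. measure lebesgue A * \<theta> m"] \<theta>(1,2)
    by (simp flip: sum_distrib_left)
qed

section \<open>Rearranging on finitely many cells at once\<close>

lemma set_integral_lebesgue_on:
  fixes f :: "'a::euclidean_space \<Rightarrow> 'b::euclidean_space"
  assumes "\<Omega> \<in> sets lebesgue" "A \<subseteq> \<Omega>"
  shows "(LINT x:A|lebesgue_on \<Omega>. f x) = (LINT x:A|lebesgue. f x)"
    and "set_integrable (lebesgue_on \<Omega>) A f \<longleftrightarrow> set_integrable lebesgue A f"
proof -
  have *: "indicator \<Omega> x * indicator A x = (indicator A x :: real)" for x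
    using assms(2) by (auto simp: indicator_def)
  show "(LINT x:A|lebesgue_on \<Omega>. f x) = (LINT x:A|lebesgue. f x)"
    using assms(1) by (simp add: set_lebesgue_integral_def integral_restrict_space *)
  show "set_integrable (lebesgue_on \<Omega>) A f \<longleftrightarrow> set_integrable lebesgue A f"
    using assms(1) by (simp add: set_integrable_def integrable_restrict_space *)
qed

text \<open>
  Here and below, a partition into finitely many cells is encoded by the map that sends a point
  to the label of its cell. Labels can then record several properties of a point at once, and
  empty cells do no harm.
\<close>

lemma sets_cell:
  assumes "h \<in> measurable M (count_space K)"
  shows "{x \<in> space M. h x = j} \<in> sets M"
proof -
  have "h -` ({j} \<inter> K) \<inter> space M \<in> sets M"
    using assms by (rule measurable_sets) auto
  also have "h -` ({j} \<inter> K) \<inter> space M = {x \<in> space M. h x = j}"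
    using measurable_space[OF assms] by auto
  finally show ?thesis .
qed

lemma integral_eq_sum_over_cells:
  fixes f :: "'a \<Rightarrow> 'b::euclidean_space"
  assumes h: "h \<in> measurable M (count_space K)" and "finite K" and f: "integrable M f"
  shows "integral\<^sup>L M f = (\<Sum>j\<in>K. LINT x:{x \<in> space M. h x = j}|M. f x)"
proof -
  have "integral\<^sup>L M f
      = (LINT x|M. (\<Sum>j\<in>K. indicator {x \<in> space M. h x = j} x *\<^sub>R f x))"
  proof (intro Bochner_Integration.integral_cong refl)
    fix x assume x: "x \<in> space M"
    then have "h x \<in> K" using measurable_space[OF h] by simp
    moreover have "(\<Sum>j\<in>K. indicator {x \<in> space M. h x = j} x *\<^sub>R f x)
        = (\<Sum>j\<in>K. if j = h x then f x else 0)"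
      using x by (intro sum.cong) (auto simp: indicator_def)
    ultimately show "f x = (\<Sum>j\<in>K. indicator {x \<in> space M. h x = j} x *\<^sub>R f x)"
      using assms(2) by simp
  qed
  also have "\<dots> = (\<Sum>j\<in>K. LINT x:{x \<in> space M. h x = j}|M. f x)"
    unfolding set_lebesgue_integral_def
    using sets_cell[OF h] f by (intro Bochner_Integration.integral_sum integrable_mult_indicator)
  finally show ?thesis .
qed

lemma rearrangement_on_cells:
  fixes \<Omega> :: "'a::euclidean_space set" and u :: "'a \<Rightarrow> 'b::euclidean_space"
  assumes \<Omega>: "\<Omega> \<in> sets lebesgue" "bounded \<Omega>"
    and h: "h \<in> measurable (lebesgue_on \<Omega>) (count_space K)" "finite K"
    and \<Phi>: "\<And>j. j \<in> K \<Longrightarrow> finite (\<Phi> j)" "\<And>j. j \<in> K \<Longrightarrow> \<Phi> j \<noteq> {}"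
    and u: "integrable (lebesgue_on \<Omega>) u" "AE x in lebesgue_on \<Omega>. u x \<in> convex hull \<Phi> (h x)"
  obtains w where "w \<in> borel_measurable (lebesgue_on \<Omega>)" "\<And>x. x \<in> \<Omega> \<Longrightarrow> w x \<in> \<Phi> (h x)"
    "\<And>j. j \<in> K \<Longrightarrow> (LINT x:{x \<in> \<Omega>. h x = j}|lebesgue_on \<Omega>. w x)
      = (LINT x:{x \<in> \<Omega>. h x = j}|lebesgue_on \<Omega>. u x)"
proof -
  define C where "C j = {x \<in> \<Omega>. h x = j}" for j
  have C_sub: "C j \<subseteq> \<Omega>" for j by (auto simp: C_def)
  have C_on: "C j \<in> sets (lebesgue_on \<Omega>)" for j
    using sets_cell[OF h(1), of j] by (simp add: C_def)
  then have C: "C j \<in> sets lebesgue" for j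
    using \<Omega>(1) by (simp add: sets_restrict_space_iff)
  have ae: "AE x in lebesgue. x \<in> \<Omega> \<longrightarrow> u x \<in> convex hull \<Phi> (h x)"
    using u(2) \<Omega>(1) by (simp add: AE_restrict_space_iff)
  have "\<forall>j\<in>K. \<exists>w. w \<in> borel_measurable lebesgue \<and> (\<forall>x\<in>C j. w x \<in> \<Phi> j)
    \<and> (LINT x:C j|lebesgue. w x) = (LINT x:C j|lebesgue. u x)"
  proof
    fix j assume "j \<in> K"
    have "bounded (C j)" using \<Omega>(2) C_sub by (rule bounded_subset)
    have "set_integrable (lebesgue_on \<Omega>) (C j) u"
      unfolding set_integrable_def using C_on u(1) by (rule integrable_mult_indicator)
    then have "set_integrable lebesgue (C j) u"
      using set_integral_lebesgue_on(2)[OF \<Omega>(1) C_sub] by blast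
    moreover have "AE x\<in>C j in lebesgue. u x \<in> convex hull \<Phi> j"
      using ae by eventually_elim (auto simp: C_def)
    ultimately show "\<exists>w. w \<in> borel_measurable lebesgue \<and> (\<forall>x\<in>C j. w x \<in> \<Phi> j)
      \<and> (LINT x:C j|lebesgue. w x) = (LINT x:C j|lebesgue. u x)"
      using rearrangement_on_cell[OF C \<open>bounded (C j)\<close> \<Phi>[OF \<open>j \<in> K\<close>]] by blast
  qed
  from bchoice[OF this] obtain w where w_all: "\<forall>j\<in>K. w j \<in> borel_measurable lebesgue
      \<and> (\<forall>x\<in>C j. w j x \<in> \<Phi> j)
      \<and> (LINT x:C j|lebesgue. w j x) = (LINT x:C j|lebesgue. u x)" ..
  have w: "w j \<in> borel_measurable lebesgue" "x \<in> C j \<Longrightarrow> w j x \<in> \<Phi> j"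
      "(LINT x:C j|lebesgue. w j x) = (LINT x:C j|lebesgue. u x)" if "j \<in> K" for j x
    using w_all[rule_format, OF that] by (simp_all only: simp_thms)
  show thesis
  proof (rule that[of "\<lambda>x. w (h x) x"])
    show "(\<lambda>x. w (h x) x) \<in> borel_measurable (lebesgue_on \<Omega>)"
    proof (rule measurable_compose_countable'[OF _ h(1) countable_finite[OF h(2)]])
      fix j assume "j \<in> K"
      then show "w j \<in> borel_measurable (lebesgue_on \<Omega>)"
        by (intro measurable_restrict_space1 w(1))
    qed
    show "w (h x) x \<in> \<Phi> (h x)" if "x \<in> \<Omega>" for x
      using that measurable_space[OF h(1), of x] by (intro w(2)) (auto simp: C_def)
    fix j assume j: "j \<in> K"
    have "(LINT x:C j|lebesgue. w (h x) x) = (LINT x:C j|lebesgue. w j x)"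
      using C by (intro set_lebesgue_integral_cong) (auto simp: C_def)
    then show "(LINT x:{x \<in> \<Omega>. h x = j}|lebesgue_on \<Omega>. w (h x) x)
      = (LINT x:{x \<in> \<Omega>. h x = j}|lebesgue_on \<Omega>. u x)"
      using w(3)[OF j] by (simp add: set_integral_lebesgue_on(1)[OF \<Omega>(1) C_sub] flip: C_def)
  qed
qed

section \<open>Square integrable fields on a set of finite measure\<close>

lemma finite_measure_lebesgue_on:
  assumes "\<Omega> \<in> lmeasurable"
  shows "finite_measure (lebesgue_on \<Omega>)"
  using assms by (intro finite_measureI) (auto simp: emeasure_restrict_space fmeasurable_def)

lemma L2_measurable: "u \<in> L2 \<Omega> \<Longrightarrow> u \<in> borel_measurable (lebesgue_on \<Omega>)"
  by (simp add: L2_def)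

lemma L2_integrable_inner:
  assumes "u \<in> L2 \<Omega>" "v \<in> L2 \<Omega>"
  shows "integrable (lebesgue_on \<Omega>) (\<lambda>x. u x \<bullet> v x)"
proof (rule Bochner_Integration.integrable_bound)
  show "integrable (lebesgue_on \<Omega>) (\<lambda>x. (norm (u x))\<^sup>2 + (norm (v x))\<^sup>2)"
    using assms by (simp add: L2_def)
  show "(\<lambda>x. u x \<bullet> v x) \<in> borel_measurable (lebesgue_on \<Omega>)"
    using assms by (auto simp: L2_def)
  have "\<bar>u x \<bullet> v x\<bar> \<le> (norm (u x))\<^sup>2 + (norm (v x))\<^sup>2" for x
  proof -
    have "\<bar>u x \<bullet> v x\<bar> \<le> norm (u x) * norm (v x)" by (rule Cauchy_Schwarz_ineq2)
    also have "\<dots> \<le> (norm (u x))\<^sup>2 + (norm (v x))\<^sup>2"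
      using sum_squares_bound[of "norm (u x)" "norm (v x)"]
        mult_nonneg_nonneg[OF norm_ge_zero[of "u x"] norm_ge_zero[of "v x"]] by linarith
    finally show ?thesis .
  qed
  then show "AE x in lebesgue_on \<Omega>. norm (u x \<bullet> v x) \<le> norm ((norm (u x))\<^sup>2 + (norm (v x))\<^sup>2)"
    by simp
qed

lemma L2_scaleR: "u \<in> L2 \<Omega> \<Longrightarrow> (\<lambda>x. r *\<^sub>R u x) \<in> L2 \<Omega>"
  by (auto simp: L2_def power_mult_distrib)

lemma L2_add:
  assumes "u \<in> L2 \<Omega>" "v \<in> L2 \<Omega>"
  shows "(\<lambda>x. u x + v x) \<in> L2 \<Omega>"
proof -
  have "integrable (lebesgue_on \<Omega>) (\<lambda>x. (norm (u x))\<^sup>2 + 2 * (u x \<bullet> v x) + (norm (v x))\<^sup>2)"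
    using assms L2_integrable_inner[OF assms] by (simp add: L2_def)
  then have "integrable (lebesgue_on \<Omega>) (\<lambda>x. (norm (u x + v x))\<^sup>2)"
    by (simp add: power2_norm_eq_inner inner_add_left inner_add_right inner_commute algebra_simps)
  then show ?thesis
    using borel_measurable_add[OF assms[THEN L2_measurable]] by (simp add: L2_def)
qed

lemma L2_diff:
  assumes "u \<in> L2 \<Omega>" "v \<in> L2 \<Omega>"
  shows "(\<lambda>x. u x - v x) \<in> L2 \<Omega>"
  using L2_add[OF assms(1) L2_scaleR[OF assms(2), of "-1"]] by simp

lemma L2_norm_nonneg: "0 \<le> L2_norm \<Omega> u"
  by (simp add: L2_norm_def L2_inner_def)

lemma L2_norm_scaleR: "L2_norm \<Omega> (\<lambda>x. r *\<^sub>R u x) = \<bar>r\<bar> * L2_norm \<Omega> u"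
  by (simp add: L2_norm_def L2_inner_def real_sqrt_mult flip: mult.assoc power2_eq_square)

lemma L2_bounded:
  assumes "\<Omega> \<in> lmeasurable" "u \<in> borel_measurable (lebesgue_on \<Omega>)"
    and "AE x in lebesgue_on \<Omega>. norm (u x) \<le> R"
  shows "u \<in> L2 \<Omega>" "L2_norm \<Omega> u \<le> sqrt (R\<^sup>2 * measure lebesgue \<Omega>)"
proof -
  interpret finite_measure "lebesgue_on \<Omega>" by (rule finite_measure_lebesgue_on[OF assms(1)])
  have sq: "AE x in lebesgue_on \<Omega>. (norm (u x))\<^sup>2 \<le> R\<^sup>2"
    using assms(3) by eventually_elim (simp add: power_mono)
  have int: "integrable (lebesgue_on \<Omega>) (\<lambda>x. (norm (u x))\<^sup>2)"
    using assms(2) sq by (intro integrable_const_bound[where B="R\<^sup>2"]) auto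
  then show "u \<in> L2 \<Omega>" using assms(2) by (simp add: L2_def)
  have "(\<integral>x. (norm (u x))\<^sup>2 \<partial>lebesgue_on \<Omega>) \<le> (\<integral>x. R\<^sup>2 \<partial>lebesgue_on \<Omega>)"
    using sq int by (intro integral_mono_AE) auto
  also have "\<dots> = R\<^sup>2 * measure lebesgue \<Omega>"
    using assms(1) by (simp add: measure_restrict_space fmeasurable_def)
  finally show "L2_norm \<Omega> u \<le> sqrt (R\<^sup>2 * measure lebesgue \<Omega>)"
    by (simp add: L2_norm_def L2_inner_def power2_norm_eq_inner)
qed

lemma L2_integrable:
  assumes "\<Omega> \<in> lmeasurable" "u \<in> L2 \<Omega>"
  shows "integrable (lebesgue_on \<Omega>) u"
proof (rule Bochner_Integration.integrable_bound)
  interpret finite_measure "lebesgue_on \<Omega>" by (rule finite_measure_lebesgue_on[OF assms(1)])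
  show "integrable (lebesgue_on \<Omega>) (\<lambda>x. 1 + (norm (u x))\<^sup>2)"
    using assms by (simp add: L2_def)
  have "norm (u x) \<le> 1 + (norm (u x))\<^sup>2" for x
    using sum_squares_bound[of 1 "norm (u x)"] norm_ge_zero[of "u x"] by (simp del: norm_ge_zero)
  then show "AE x in lebesgue_on \<Omega>. norm (u x) \<le> norm (1 + (norm (u x))\<^sup>2)"
    by simp
qed (use assms in \<open>simp add: L2_def\<close>)

section \<open>Weak convergence of rearrangements on ever finer cells\<close>

text \<open>
  Truncation makes the field bounded at a small cost in the mean; a bounded field is then
  approximated by truncating continuous fields that converge to it almost everywhere, and
  the truncation level is an integrable majorant.
\<close>

lemma integrable_approx_continuous:
  fixes \<phi> :: "'a::euclidean_space \<Rightarrow> 'b::euclidean_space"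
  assumes \<Omega>: "\<Omega> \<in> lmeasurable" and \<phi>: "integrable (lebesgue_on \<Omega>) \<phi>" and "0 < e"
  obtains \<psi> where "continuous_on UNIV \<psi>" "integrable (lebesgue_on \<Omega>) \<psi>"
    "(\<integral>x. norm (\<phi> x - \<psi> x) \<partial>lebesgue_on \<Omega>) < e"
proof -
  interpret finite_measure "lebesgue_on \<Omega>" by (rule finite_measure_lebesgue_on[OF \<Omega>])
  define clip where "clip n = closest_point (cball (0::'b) (real n))" for n
  have clip_self: "clip n v = v" if "norm v \<le> real n" for n v
    using that by (simp add: clip_def closest_point_self)
  have clip_cont: "continuous_on S (clip n)" for n S
    unfolding clip_def by (intro continuous_on_closest_point) auto
  have clip_le: "norm (clip n v) \<le> real n" for n v
    using closest_point_in_set[of "cball 0 (real n)" v] by (simp add: clip_def)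
  have clip_le_norm: "norm (clip n v) \<le> norm v" for n v
    using closest_point_lipschitz[of "cball 0 (real n)" v 0] clip_self[of 0 n]
    by (simp add: clip_def)
  have clip_meas: "(\<lambda>x. clip n (f x)) \<in> borel_measurable (lebesgue_on \<Omega>)"
    if "f \<in> borel_measurable (lebesgue_on \<Omega>)" for n and f :: "'a \<Rightarrow> 'b"
    using borel_measurable_continuous_onI[OF clip_cont] that by measurable
  have \<phi>_meas: "\<phi> \<in> borel_measurable (lebesgue_on \<Omega>)" using \<phi> by simp
  have "(\<lambda>n. \<integral>x. norm (\<phi> x - clip n (\<phi> x)) \<partial>lebesgue_on \<Omega>) \<longlonglongrightarrow> (\<integral>x. 0 \<partial>lebesgue_on \<Omega>)"
  proof (rule integral_dominated_convergence[where w="\<lambda>x. 2 * norm (\<phi> x)"])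
    show "AE x in lebesgue_on \<Omega>. (\<lambda>n. norm (\<phi> x - clip n (\<phi> x))) \<longlonglongrightarrow> 0"
    proof (rule AE_I2, rule tendsto_eventually)
      fix x
      obtain N where "norm (\<phi> x) \<le> real N" using real_arch_simple by blast
      then show "\<forall>\<^sub>F n in sequentially. norm (\<phi> x - clip n (\<phi> x)) = 0"
        by (intro eventually_sequentiallyI[of N]) (auto simp: clip_self)
    qed
    show "AE x in lebesgue_on \<Omega>. norm (norm (\<phi> x - clip n (\<phi> x))) \<le> 2 * norm (\<phi> x)" for n
      using norm_triangle_ineq4[of "\<phi> _" "clip n (\<phi> _)"] clip_le_norm[of n "\<phi> _"]
      by (intro AE_I2) (smt (verit) norm_ge_zero real_norm_def abs_of_nonneg)
  qed (use \<phi> clip_meas[OF \<phi>_meas] in auto)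
  then have "\<forall>\<^sub>F n in sequentially. (\<integral>x. norm (\<phi> x - clip n (\<phi> x)) \<partial>lebesgue_on \<Omega>) < e / 2"
    using \<open>0 < e\<close> by (intro order_tendstoD(2)) auto
  then obtain n where n: "(\<integral>x. norm (\<phi> x - clip n (\<phi> x)) \<partial>lebesgue_on \<Omega>) < e / 2"
    using eventually_happens'[OF sequentially_bot] by blast
  have "\<phi> measurable_on \<Omega>"
    using measurable_on_iff_borel_measurable \<Omega> \<phi>_meas by (auto simp: fmeasurable_def)
  then obtain N g where N: "negligible N" and g: "\<And>k. continuous_on UNIV (g k)"
      "\<And>x. x \<notin> N \<Longrightarrow> (\<lambda>k. g k x) \<longlonglongrightarrow> (if x \<in> \<Omega> then \<phi> x else 0)"
    unfolding measurable_on_def by blast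
  have g_meas: "g k \<in> borel_measurable (lebesgue_on \<Omega>)" for k
    using borel_measurable_continuous_onI[OF g(1)[of k]]
    by (intro measurable_restrict_space1 measurable_completion) auto
  have clip_int: "integrable (lebesgue_on \<Omega>) (\<lambda>x. clip n (f x))"
    if "f \<in> borel_measurable (lebesgue_on \<Omega>)" for f :: "'a \<Rightarrow> 'b"
    using clip_meas[OF that] clip_le by (intro integrable_const_bound[where B="real n"]) auto
  have "(\<lambda>k. \<integral>x. norm (clip n (\<phi> x) - clip n (g k x)) \<partial>lebesgue_on \<Omega>)
      \<longlonglongrightarrow> (\<integral>x. 0 \<partial>lebesgue_on \<Omega>)"
  proof (rule integral_dominated_convergence[where w="\<lambda>x. 2 * real n"])
    have "AE x in lebesgue. x \<notin> N"
      using N by (intro AE_not_in) (simp flip: negligible_iff_null_sets)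
    then have "AE x in lebesgue_on \<Omega>. x \<notin> N \<and> x \<in> \<Omega>"
      using \<Omega> by (subst AE_restrict_space_iff) (auto simp: fmeasurable_def)
    then show "AE x in lebesgue_on \<Omega>. (\<lambda>k. norm (clip n (\<phi> x) - clip n (g k x))) \<longlonglongrightarrow> 0"
    proof eventually_elim
      case (elim x)
      then have "(\<lambda>k. g k x) \<longlonglongrightarrow> \<phi> x" using g(2)[of x] by simp
      then have "(\<lambda>k. clip n (g k x)) \<longlonglongrightarrow> clip n (\<phi> x)"
        using clip_cont[of UNIV n] by (intro continuous_on_tendsto_compose[of UNIV "clip n"]) auto
      then have "(\<lambda>k. norm (clip n (\<phi> x) - clip n (g k x))) \<longlonglongrightarrow> norm (clip n (\<phi> x) - clip n (\<phi> x))"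
        by (intro tendsto_intros)
      then show ?case by simp
    qed
    show "AE x in lebesgue_on \<Omega>. norm (norm (clip n (\<phi> x) - clip n (g k x))) \<le> 2 * real n" for k
    proof (rule AE_I2)
      fix x
      show "norm (norm (clip n (\<phi> x) - clip n (g k x))) \<le> 2 * real n"
        using norm_triangle_ineq4[of "clip n (\<phi> x)" "clip n (g k x)"]
          clip_le[of n "\<phi> x"] clip_le[of n "g k x"] by simp
    qed
  qed (use clip_meas[OF \<phi>_meas] clip_meas[OF g_meas] in auto)
  then have "\<forall>\<^sub>F k in sequentially. (\<integral>x. norm (clip n (\<phi> x) - clip n (g k x)) \<partial>lebesgue_on \<Omega>) < e / 2"
    using \<open>0 < e\<close> by (intro order_tendstoD(2)) auto
  then obtain k where k: "(\<integral>x. norm (clip n (\<phi> x) - clip n (g k x)) \<partial>lebesgue_on \<Omega>) < e / 2"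
    using eventually_happens'[OF sequentially_bot] by blast
  show thesis
  proof (rule that[of "\<lambda>x. clip n (g k x)"])
    show "continuous_on UNIV (\<lambda>x. clip n (g k x))"
      by (rule continuous_on_compose2[OF clip_cont[of UNIV] g(1)]) auto
    show "integrable (lebesgue_on \<Omega>) (\<lambda>x. clip n (g k x))" by (rule clip_int[OF g_meas])
    have "(\<integral>x. norm (\<phi> x - clip n (g k x)) \<partial>lebesgue_on \<Omega>)
        \<le> (\<integral>x. norm (\<phi> x - clip n (\<phi> x)) + norm (clip n (\<phi> x) - clip n (g k x)) \<partial>lebesgue_on \<Omega>)"
      using \<phi> clip_int[OF \<phi>_meas] clip_int[OF g_meas]
      by (intro integral_mono) (auto intro: norm_triangle_ineq4 norm_diff_triangle_ineq
          order_trans[OF _ norm_triangle_ineq])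
    also have "\<dots> < e"
      using \<phi> clip_int[OF \<phi>_meas] clip_int[OF g_meas] n k by simp
    finally show "(\<integral>x. norm (\<phi> x - clip n (g k x)) \<partial>lebesgue_on \<Omega>) < e" .
  qed
qed

text \<open>
  A test field that is constant on each cell cannot distinguish fields with equal cell integrals.
  Up to a small error in the mean every test field is uniformly continuous, hence nearly constant
  on small cells; the common bound \<open>R\<close> turns this error into an error of the inner product.
\<close>

lemma L2_weakly_tendsto_if_cell_integrals_eq:
  fixes \<Omega> :: "'a::euclidean_space set" and u :: "'a \<Rightarrow> 'b::euclidean_space"
  assumes \<Omega>: "\<Omega> \<in> sets lebesgue" "bounded \<Omega>"
    and u: "u \<in> borel_measurable (lebesgue_on \<Omega>)" "AE x in lebesgue_on \<Omega>. norm (u x) \<le> R"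
    and us: "\<And>k. us k \<in> borel_measurable (lebesgue_on \<Omega>)"
      "\<And>k. AE x in lebesgue_on \<Omega>. norm (us k x) \<le> R"
    and h: "\<And>k. h k \<in> measurable (lebesgue_on \<Omega>) (count_space (K k))" "\<And>k. finite (K k)"
    and cells: "\<And>k j. j \<in> K k \<Longrightarrow> (LINT x:{x \<in> \<Omega>. h k x = j}|lebesgue_on \<Omega>. us k x)
      = (LINT x:{x \<in> \<Omega>. h k x = j}|lebesgue_on \<Omega>. u x)"
    and diam: "\<And>k x y. x \<in> \<Omega> \<Longrightarrow> y \<in> \<Omega> \<Longrightarrow> h k x = h k y \<Longrightarrow> dist x y < \<delta> k" "\<delta> \<longlonglongrightarrow> 0"
  shows "L2_weakly_tendsto \<Omega> us u"
proof -
  let ?M = "lebesgue_on \<Omega>"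
  have lm: "\<Omega> \<in> lmeasurable" using \<Omega> by (intro bounded_set_imp_lmeasurable)
  interpret finite_measure ?M by (rule finite_measure_lebesgue_on[OF lm])
  have L2: "u \<in> L2 \<Omega>" "us k \<in> L2 \<Omega>" for k
    using L2_bounded(1)[OF lm] u us by blast+
  have D_le: "AE x in ?M. norm (us k x - u x) \<le> 2 * \<bar>R\<bar>" for k
    using u(2) us(2)[of k]
  proof eventually_elim
    case (elim x)
    then show ?case using norm_triangle_ineq4[of "us k x" "u x"] by linarith
  qed
  have D_int: "integrable ?M (\<lambda>x. us k x - u x)" for k
    by (intro Bochner_Integration.integrable_diff L2_integrable[OF lm] L2)
  have "(\<lambda>k. L2_inner \<Omega> (us k) \<phi> - L2_inner \<Omega> u \<phi>) \<longlonglongrightarrow> 0" if \<phi>: "\<phi> \<in> L2 \<Omega>" for \<phi>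
  proof (rule LIMSEQ_I)
    fix r :: real assume "0 < r"
    define q where "q = 2 * \<bar>R\<bar> * (1 + measure ?M \<Omega>)"
    have q: "0 \<le> q" unfolding q_def by (intro mult_nonneg_nonneg add_nonneg_nonneg) auto
    define e where "e = r / (q + 1)"
    have e: "0 < e" "q * e < r"
      using \<open>0 < r\<close> q by (simp_all add: e_def field_simps)
    have \<phi>_int: "integrable ?M \<phi>" by (rule L2_integrable[OF lm \<phi>])
    obtain \<psi> where \<psi>: "continuous_on UNIV \<psi>" "integrable ?M \<psi>"
        "(\<integral>x. norm (\<phi> x - \<psi> x) \<partial>?M) < e"
      using integrable_approx_continuous[OF lm \<phi>_int e(1)] by blast
    have "uniformly_continuous_on (closure \<Omega>) \<psi>"
      using \<Omega>(2) \<psi>(1) by (intro compact_uniformly_continuous)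
        (auto intro: continuous_on_subset simp: compact_closure)
    then obtain d where d: "0 < d"
        "\<And>x y. x \<in> \<Omega> \<Longrightarrow> y \<in> \<Omega> \<Longrightarrow> dist x y < d \<Longrightarrow> dist (\<psi> x) (\<psi> y) < e"
      unfolding uniformly_continuous_on_def using e(1) closure_subset[of \<Omega>]
      by (metis subsetD)
    obtain k0 where k0: "\<And>k. k0 \<le> k \<Longrightarrow> \<delta> k < d"
      using order_tendstoD(2)[OF diam(2) d(1)] by (auto simp: eventually_sequentially)
    have "norm (L2_inner \<Omega> (us k) \<phi> - L2_inner \<Omega> u \<phi> - 0) < r" if "k0 \<le> k" for k
    proof -
      \<comment> \<open>Freeze the test field on each cell at the value in one representative of the cell.\<close>
      define \<sigma> where "\<sigma> j = \<psi> (SOME x. x \<in> \<Omega> \<and> h k x = j)" for j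
      have \<sigma>_near: "norm (\<psi> x - \<sigma> (h k x)) \<le> e" if "x \<in> \<Omega>" for x
      proof -
        define y where "y = (SOME y. y \<in> \<Omega> \<and> h k y = h k x)"
        have y: "y \<in> \<Omega>" "h k y = h k x"
          unfolding y_def using someI[where P="\<lambda>y. y \<in> \<Omega> \<and> h k y = h k x" and x=x] that by auto
        have "dist x y < d"
          using diam(1)[OF that y(1) y(2)[symmetric]] k0[OF \<open>k0 \<le> k\<close>] by linarith
        then have "dist (\<psi> x) (\<sigma> (h k x)) < e"
          unfolding \<sigma>_def y_def[symmetric] by (rule d(2)[OF that y(1)])
        then show ?thesis by (simp add: dist_norm)
      qed
      have "(\<lambda>j. \<sigma> j) \<in> measurable (count_space (K k)) borel" by simp
      then have \<sigma>_meas: "(\<lambda>x. \<sigma> (h k x)) \<in> borel_measurable ?M"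
        using measurable_compose[OF h(1)] by blast
      have \<sigma>_int: "integrable ?M (\<lambda>x. \<sigma> (h k x))"
      proof -
        obtain B where "\<And>v. v \<in> \<sigma> ` K k \<Longrightarrow> norm v \<le> B"
          using finite_imp_bounded[OF finite_imageI[OF h(2), of \<sigma> k]] unfolding bounded_iff by blast
        then show ?thesis
          using \<sigma>_meas measurable_space[OF h(1)[of k]] by (intro integrable_const_bound[where B=B]) auto
      qed
      have prod_int: "integrable ?M (\<lambda>x. (us k x - u x) \<bullet> f x)"
        if "integrable ?M f" for f
      proof (rule Bochner_Integration.integrable_bound)
        show "integrable ?M (\<lambda>x. 2 * \<bar>R\<bar> * norm (f x))" using that by simp
        show "(\<lambda>x. (us k x - u x) \<bullet> f x) \<in> borel_measurable ?M" using that D_int[of k] by auto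
        show "AE x in ?M. norm ((us k x - u x) \<bullet> f x) \<le> norm (2 * \<bar>R\<bar> * norm (f x))"
          using D_le[of k]
        proof eventually_elim
          case (elim x)
          have "\<bar>(us k x - u x) \<bullet> f x\<bar> \<le> norm (us k x - u x) * norm (f x)"
            by (rule Cauchy_Schwarz_ineq2)
          also have "\<dots> \<le> 2 * \<bar>R\<bar> * norm (f x)" using elim by (intro mult_right_mono) auto
          finally show ?case by (simp add: abs_mult)
        qed
      qed
      have "(\<integral>x. (us k x - u x) \<bullet> \<sigma> (h k x) \<partial>?M)
          = (\<Sum>j\<in>K k. LINT x:{x \<in> \<Omega>. h k x = j}|?M. (us k x - u x) \<bullet> \<sigma> (h k x))"
        using integral_eq_sum_over_cells[OF h prod_int[OF \<sigma>_int]] by simp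
      also have "\<dots> = 0"
      proof (intro sum.neutral ballI)
        fix j assume j: "j \<in> K k"
        let ?C = "{x \<in> \<Omega>. h k x = j}"
        have C: "?C \<in> sets ?M" using sets_cell[OF h(1), of k j] by simp
        have C_int: "integrable ?M (\<lambda>x. indicator ?C x *\<^sub>R v x)" if "integrable ?M v" for v :: "'a \<Rightarrow> 'b"
          using C that by (rule integrable_mult_indicator)
        have "(LINT x:?C|?M. us k x - u x) = 0"
          using cells[OF j] C_int[OF L2_integrable[OF lm L2(1)]] C_int[OF L2_integrable[OF lm L2(2)]]
          by (subst set_integral_diff) (auto simp: set_integrable_def)
        moreover have "(LINT x:?C|?M. (us k x - u x) \<bullet> \<sigma> (h k x))
            = (\<integral>x. (indicator ?C x *\<^sub>R (us k x - u x)) \<bullet> \<sigma> j \<partial>?M)"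
          unfolding set_lebesgue_integral_def
          by (intro Bochner_Integration.integral_cong refl) (auto simp: indicator_def)
        moreover have "\<dots> = (LINT x:?C|?M. us k x - u x) \<bullet> \<sigma> j"
          unfolding set_lebesgue_integral_def by (rule integral_inner_left[OF C_int[OF D_int]])
        ultimately show "(LINT x:?C|?M. (us k x - u x) \<bullet> \<sigma> (h k x)) = 0" by simp
      qed
      finally have \<sigma>_zero: "(\<integral>x. (us k x - u x) \<bullet> \<sigma> (h k x) \<partial>?M) = 0" .
      have "L2_inner \<Omega> (us k) \<phi> - L2_inner \<Omega> u \<phi> = (\<integral>x. (us k x - u x) \<bullet> \<phi> x \<partial>?M)"
        using L2_integrable_inner[OF L2(1) \<phi>] L2_integrable_inner[OF L2(2) \<phi>]
        by (simp add: L2_inner_def inner_diff_left)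
      also have "\<dots> = (\<integral>x. (us k x - u x) \<bullet> (\<phi> x - \<sigma> (h k x)) \<partial>?M)"
        using prod_int[OF \<phi>_int] prod_int[OF \<sigma>_int] \<sigma>_zero by (simp add: inner_diff_right)
      also have "norm \<dots> \<le> (\<integral>x. norm ((us k x - u x) \<bullet> (\<phi> x - \<sigma> (h k x))) \<partial>?M)"
        by (rule integral_norm_bound)
      also have "\<dots> \<le> (\<integral>x. 2 * \<bar>R\<bar> * (norm (\<phi> x - \<psi> x) + e) \<partial>?M)"
      proof (rule integral_mono_AE)
        show "integrable ?M (\<lambda>x. norm ((us k x - u x) \<bullet> (\<phi> x - \<sigma> (h k x))))"
          using \<phi>_int \<sigma>_int by (intro integrable_norm prod_int) auto
        show "integrable ?M (\<lambda>x. 2 * \<bar>R\<bar> * (norm (\<phi> x - \<psi> x) + e))"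
          using \<phi>_int \<psi>(2) by auto
        show "AE x in ?M. norm ((us k x - u x) \<bullet> (\<phi> x - \<sigma> (h k x)))
            \<le> 2 * \<bar>R\<bar> * (norm (\<phi> x - \<psi> x) + e)"
          using D_le[of k] AE_space
        proof eventually_elim
          case (elim x)
          have "norm (\<phi> x - \<sigma> (h k x)) \<le> norm (\<phi> x - \<psi> x) + norm (\<psi> x - \<sigma> (h k x))"
            using norm_triangle_ineq[of "\<phi> x - \<psi> x" "\<psi> x - \<sigma> (h k x)"] by simp
          also have "\<dots> \<le> norm (\<phi> x - \<psi> x) + e" using \<sigma>_near elim(2) by simp
          finally have near: "norm (\<phi> x - \<sigma> (h k x)) \<le> norm (\<phi> x - \<psi> x) + e" .
          have "\<bar>(us k x - u x) \<bullet> (\<phi> x - \<sigma> (h k x))\<bar>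
              \<le> norm (us k x - u x) * norm (\<phi> x - \<sigma> (h k x))"
            by (rule Cauchy_Schwarz_ineq2)
          also have "\<dots> \<le> 2 * \<bar>R\<bar> * (norm (\<phi> x - \<psi> x) + e)"
            using elim(1) near by (intro mult_mono) auto
          finally show ?case by simp
        qed
      qed
      also have "\<dots> = 2 * \<bar>R\<bar> * ((\<integral>x. norm (\<phi> x - \<psi> x) \<partial>?M) + e * measure ?M \<Omega>)"
        using \<phi>_int \<psi>(2) by (simp add: mult.commute)
      also have "\<dots> \<le> 2 * \<bar>R\<bar> * (e + e * measure ?M \<Omega>)"
        using \<psi>(3) by (intro mult_left_mono) auto
      also have "\<dots> = q * e" by (simp add: q_def algebra_simps)
      finally show ?thesis using e(2) by simp
    qed
    then show "\<exists>no. \<forall>n\<ge>no. norm (L2_inner \<Omega> (us n) \<phi> - L2_inner \<Omega> u \<phi> - 0) < r" by blast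
  qed
  then show ?thesis
    using L2 LIM_zero_iff unfolding L2_weakly_tendsto_def by blast
qed

section \<open>The energy of a linear problem and its minimizers\<close>

lemma nn_integral_regularizer:
  assumes "0 \<le> \<alpha>" "\<And>v. 0 \<le> c v" and G: "integrable N G"
    and eq: "AE x in N. regularizer \<alpha> c M (u x) = ereal (G x)"
  shows "(\<integral>\<^sup>+x. e2ennreal (regularizer \<alpha> c M (u x)) \<partial>N) = ennreal (\<integral>x. G x \<partial>N)"
    and "0 \<le> (\<integral>x. G x \<partial>N)"
proof -
  have nonneg: "AE x in N. 0 \<le> G x"
    using eq
  proof eventually_elim
    case (elim x)
    then show ?case using regularizer_nonneg[where c=c, OF assms(1,2), where M=M and v="u x"] by simp
  qed
  have "(\<integral>\<^sup>+x. e2ennreal (regularizer \<alpha> c M (u x)) \<partial>N) = (\<integral>\<^sup>+x. ennreal (G x) \<partial>N)"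
    using eq by (intro nn_integral_cong_AE) (auto elim!: eventually_mono simp: e2ennreal_ereal)
  also have "\<dots> = ennreal (\<integral>x. G x \<partial>N)"
    using G nonneg by (rule nn_integral_eq_integral)
  finally show "(\<integral>\<^sup>+x. e2ennreal (regularizer \<alpha> c M (u x)) \<partial>N) = ennreal (\<integral>x. G x \<partial>N)" .
  show "0 \<le> (\<integral>x. G x \<partial>N)"
    using nonneg by (rule integral_nonneg_AE)
qed

lemma energy_eq:
  assumes "0 \<le> \<alpha>" "\<And>v. 0 \<le> c v" "integrable (lebesgue_on \<Omega>) G"
    and "AE x in lebesgue_on \<Omega>. regularizer \<alpha> c M (u x) = ereal (G x)"
  shows "energy \<Omega> \<alpha> c M S z u = ennreal ((norm (S u - z))\<^sup>2 / 2 + (\<integral>x. G x \<partial>lebesgue_on \<Omega>))"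
  using nn_integral_regularizer[where c=c, OF assms] unfolding energy_def by (simp add: ennreal_plus)

lemma energy_finiteE:
  fixes M :: "'b::euclidean_space set"
  assumes "finite M" "M \<noteq> {}" "0 \<le> \<alpha>" "\<And>v. 0 \<le> c v"
    and u: "u \<in> borel_measurable (lebesgue_on \<Omega>)" and fin: "energy \<Omega> \<alpha> c M S z u < \<infinity>"
  obtains G where "integrable (lebesgue_on \<Omega>) G"
    "AE x in lebesgue_on \<Omega>. regularizer \<alpha> c M (u x) = ereal (G x)"
proof (rule that)
  let ?g = "regularizer \<alpha> c M"
  have g_meas: "(\<lambda>x. ?g (u x)) \<in> borel_measurable (lebesgue_on \<Omega>)"
    using measurable_compose[OF u borel_measurable_regularizer[OF assms(1,2)]] .
  have nonneg: "0 \<le> ?g v" for v by (rule regularizer_nonneg[where c=c, OF assms(3,4)])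
  have int: "(\<integral>\<^sup>+x. e2ennreal (?g (u x)) \<partial>lebesgue_on \<Omega>) \<noteq> \<infinity>"
    using fin by (auto simp: energy_def)
  have "AE x in lebesgue_on \<Omega>. e2ennreal (?g (u x)) \<noteq> \<infinity>"
    using g_meas int by (intro nn_integral_PInf_AE) auto
  then show eq: "AE x in lebesgue_on \<Omega>. ?g (u x) = ereal (real_of_ereal (?g (u x)))"
  proof eventually_elim
    case (elim x)
    then show ?case using nonneg[of "u x"] by (cases "?g (u x)") (auto simp: infinity_ennreal_def)
  qed
  have "(\<integral>\<^sup>+x. ennreal (real_of_ereal (?g (u x))) \<partial>lebesgue_on \<Omega>)
      = (\<integral>\<^sup>+x. e2ennreal (?g (u x)) \<partial>lebesgue_on \<Omega>)"
  proof (rule nn_integral_cong_AE)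
    show "AE x in lebesgue_on \<Omega>. ennreal (real_of_ereal (?g (u x))) = e2ennreal (?g (u x))"
      using eq by eventually_elim (metis e2ennreal_ereal)
  qed
  then show "integrable (lebesgue_on \<Omega>) (\<lambda>x. real_of_ereal (?g (u x)))"
    using g_meas int nonneg
    by (intro integrableI_nonneg) (auto simp: real_of_ereal_pos top.not_eq_extremum)
qed

lemma integrable_finite_conjugate:
  fixes p :: "'a::euclidean_space \<Rightarrow> 'b::euclidean_space"
  assumes M: "finite M" "M \<noteq> {}" and \<Omega>: "\<Omega> \<in> lmeasurable" and p: "p \<in> L2 \<Omega>"
  shows "integrable (lebesgue_on \<Omega>) (\<lambda>x. finite_conjugate b M (p x))"
proof (rule Bochner_Integration.integrable_bound)
  interpret finite_measure "lebesgue_on \<Omega>" by (rule finite_measure_lebesgue_on[OF \<Omega>])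
  show "integrable (lebesgue_on \<Omega>) (\<lambda>x. \<Sum>m\<in>M. \<bar>p x \<bullet> m - b m\<bar>)"
    using L2_integrable[OF \<Omega> p] by auto
  show "(\<lambda>x. finite_conjugate b M (p x)) \<in> borel_measurable (lebesgue_on \<Omega>)"
    using measurable_compose[OF L2_measurable[OF p] borel_measurable_finite_conjugate[OF M]] .
  have "\<bar>finite_conjugate b M q\<bar> \<le> (\<Sum>m\<in>M. \<bar>q \<bullet> m - b m\<bar>)" for q
  proof -
    obtain m where m: "m \<in> M" "finite_conjugate b M q = q \<bullet> m - b m"
      using active_points_nonempty[OF M, of b q] by (auto simp: active_points_def)
    show ?thesis unfolding m(2) using M(1) m(1) by (intro member_le_sum) auto
  qed
  then show "AE x in lebesgue_on \<Omega>. norm (finite_conjugate b M (p x))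
      \<le> norm (\<Sum>m\<in>M. \<bar>p x \<bullet> m - b m\<bar>)"
    by (simp add: sum_nonneg)
qed

text \<open>
  On the faces selected by \<open>p\<close> the energy depends on \<open>u\<close> only through \<open>S u\<close> and the
  inner product with \<open>p\<close>. This is what makes exact equality of energies attainable.
\<close>

lemma energy_on_faces:
  fixes p :: "'a::euclidean_space \<Rightarrow> 'b::euclidean_space"
  assumes M: "finite M" "M \<noteq> {}" and \<alpha>c: "0 \<le> \<alpha>" "\<And>v. 0 \<le> c v"
    and \<Omega>: "\<Omega> \<in> lmeasurable" and p: "p \<in> L2 \<Omega>" and u: "u \<in> L2 \<Omega>"
    and face: "AE x in lebesgue_on \<Omega>. u x \<in> convex hull (active_points (\<lambda>v. \<alpha> * c v) M (p x))"
  shows "energy \<Omega> \<alpha> c M S z u = ennreal ((norm (S u - z))\<^sup>2 / 2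
    + (L2_inner \<Omega> p u - (\<integral>x. finite_conjugate (\<lambda>v. \<alpha> * c v) M (p x) \<partial>lebesgue_on \<Omega>)))"
proof -
  let ?k = "finite_conjugate (\<lambda>v. \<alpha> * c v) M"
  have int: "integrable (lebesgue_on \<Omega>) (\<lambda>x. p x \<bullet> u x)"
      "integrable (lebesgue_on \<Omega>) (\<lambda>x. ?k (p x))"
    using L2_integrable_inner[OF p u] integrable_finite_conjugate[OF M \<Omega> p] .
  have "energy \<Omega> \<alpha> c M S z u
      = ennreal ((norm (S u - z))\<^sup>2 / 2 + (\<integral>x. p x \<bullet> u x - ?k (p x) \<partial>lebesgue_on \<Omega>))"
  proof (rule energy_eq[where c=c, OF \<alpha>c])
    show "integrable (lebesgue_on \<Omega>) (\<lambda>x. p x \<bullet> u x - ?k (p x))" using int by simp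
    show "AE x in lebesgue_on \<Omega>. regularizer \<alpha> c M (u x) = ereal (p x \<bullet> u x - ?k (p x))"
      using face by eventually_elim (rule regularizer_eq_on_face[OF M])
  qed
  then show ?thesis using int by (simp add: L2_inner_def)
qed

lemma L2_linear_diff:
  assumes "L2_linear \<Omega> S" "u \<in> L2 \<Omega>" "v \<in> L2 \<Omega>"
  shows "S (\<lambda>x. u x - v x) = S u - S v"
proof -
  have "S (\<lambda>x. u x + (- 1) *\<^sub>R v x) = S u + S (\<lambda>x. (- 1) *\<^sub>R v x)"
    using assms(1)[unfolded L2_linear_def, THEN conjunct1, rule_format, OF assms(2)
        L2_scaleR[OF assms(3), of "- 1"]] .
  also have "S (\<lambda>x. (- 1) *\<^sub>R v x) = (- 1) *\<^sub>R S v"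
    using assms unfolding L2_linear_def by blast
  finally show ?thesis by simp
qed

text \<open>
  Sufficiency of the first order condition, for the dual field \<open>p\<close>, the adjoint of \<open>S\<close> applied
  to the residual: both terms of the energy lie above their linearizations at \<open>u\<close>, and the
  linear terms cancel.
\<close>

lemma minimizer_if_on_faces:
  fixes S :: "('a::euclidean_space \<Rightarrow> 'b::euclidean_space) \<Rightarrow> 'y::real_inner"
  assumes M: "finite M" "M \<noteq> {}" and \<alpha>c: "0 \<le> \<alpha>" "\<And>v. 0 \<le> c v"
    and \<Omega>: "\<Omega> \<in> lmeasurable" and S: "L2_linear \<Omega> S"
    and p: "L2_adjoint_at \<Omega> S (z - S u) p" and u: "u \<in> L2 \<Omega>"
    and face: "AE x in lebesgue_on \<Omega>. u x \<in> convex hull (active_points (\<lambda>v. \<alpha> * c v) M (p x))"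
  shows "L2_minimizer \<Omega> (energy \<Omega> \<alpha> c M S z) u"
  unfolding L2_minimizer_def
proof (intro conjI ballI u)
  fix v :: "'a \<Rightarrow> 'b" assume v: "v \<in> L2 \<Omega>"
  let ?M = "lebesgue_on \<Omega>" and ?k = "finite_conjugate (\<lambda>v. \<alpha> * c v) M"
  have p_L2: "p \<in> L2 \<Omega>" using p by (simp add: L2_adjoint_at_def)
  show "energy \<Omega> \<alpha> c M S z u \<le> energy \<Omega> \<alpha> c M S z v"
  proof (cases "energy \<Omega> \<alpha> c M S z v < \<infinity>")
    case False
    then show ?thesis by (simp add: not_less top_unique)
  next
    case True
    then obtain G where G: "integrable ?M G" "AE x in ?M. regularizer \<alpha> c M (v x) = ereal (G x)"
      using energy_finiteE[where c=c, OF M \<alpha>c L2_measurable[OF v]] by blast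
    have int: "integrable ?M (\<lambda>x. p x \<bullet> v x)" "integrable ?M (\<lambda>x. ?k (p x))"
      using L2_integrable_inner[OF p_L2 v] integrable_finite_conjugate[OF M \<Omega> p_L2] .
    have "L2_inner \<Omega> p v - (\<integral>x. ?k (p x) \<partial>?M) = (\<integral>x. p x \<bullet> v x - ?k (p x) \<partial>?M)"
      using int by (simp add: L2_inner_def)
    also have "\<dots> \<le> (\<integral>x. G x \<partial>?M)"
    proof (rule integral_mono_AE)
      show "integrable ?M (\<lambda>x. p x \<bullet> v x - ?k (p x))" using int by simp
      show "AE x in ?M. p x \<bullet> v x - ?k (p x) \<le> G x"
        using G(2)
      proof eventually_elim
        case (elim x)
        then show ?case using regularizer_ge[OF M, where q="p x" and v="v x" and \<alpha>=\<alpha> and c=c] by simp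
      qed
    qed (rule G(1))
    finally have reg: "L2_inner \<Omega> p v - (\<integral>x. ?k (p x) \<partial>?M) \<le> (\<integral>x. G x \<partial>?M)" .
    have "S (\<lambda>x. v x - u x) \<bullet> (z - S u) = L2_inner \<Omega> (\<lambda>x. v x - u x) p"
      using p L2_diff[OF v u] by (simp add: L2_adjoint_at_def)
    then have slope: "(S v - S u) \<bullet> (z - S u) = L2_inner \<Omega> p v - L2_inner \<Omega> p u"
      using L2_linear_diff[OF S v u] L2_integrable_inner[OF p_L2 u] int(1)
      by (simp add: L2_inner_def inner_commute inner_diff_right)
    have "(norm (S v - z))\<^sup>2 = (norm (S u - z))\<^sup>2 - 2 * ((S v - S u) \<bullet> (z - S u)) + (norm (S v - S u))\<^sup>2"
      unfolding power2_norm_eq_inner by (simp add: algebra_simps inner_diff_left inner_diff_right inner_commute)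
    then have "(norm (S u - z))\<^sup>2 - 2 * ((S v - S u) \<bullet> (z - S u)) \<le> (norm (S v - z))\<^sup>2" by simp
    then show ?thesis
      unfolding energy_on_faces[where c=c, OF M \<alpha>c \<Omega> p_L2 u face] energy_eq[where c=c, OF \<alpha>c G]
      using reg slope by (intro ennreal_leI) simp
  qed
qed

lemma slope_nonneg_if_quadratic_nonneg:
  fixes A B :: real
  assumes "\<And>t. 0 < t \<Longrightarrow> t \<le> 1 \<Longrightarrow> 0 \<le> t * A + t\<^sup>2 * B"
  shows "0 \<le> A"
proof (rule tendsto_lowerbound)
  show "((\<lambda>t. A + t * B) \<longlongrightarrow> A) (at_right 0)"
    by (auto intro!: tendsto_eq_intros)
  have "\<forall>\<^sub>F t::real in at_right 0. t < 1"
    by (rule eventually_at_rightI[of 0 1]) auto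
  with eventually_at_right_less[of 0] show "\<forall>\<^sub>F t in at_right 0. 0 \<le> A + t * B"
  proof eventually_elim
    case (elim t)
    then have "0 \<le> t * (A + t * B)"
      using assms[of t] by (simp add: algebra_simps power2_eq_square)
    with elim(1) show ?case by (simp add: zero_le_mult_iff)
  qed
qed simp

lemma measurable_finite_subset:
  assumes "finite A" and meas: "\<And>a. a \<in> A \<Longrightarrow> {x \<in> space N. P a x} \<in> sets N"
    and K: "K \<subseteq> Pow A" "\<And>x. x \<in> space N \<Longrightarrow> {a \<in> A. P a x} \<in> K"
  shows "(\<lambda>x. {a \<in> A. P a x}) \<in> measurable N (count_space K)"
proof -
  have "finite K" using K(1) assms(1) by (auto intro: finite_subset)
  moreover have "(\<lambda>x. {a \<in> A. P a x}) -` {B} \<inter> space N \<in> sets N" if "B \<in> K" for B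
  proof -
    have "(\<lambda>x. {a \<in> A. P a x}) -` {B} \<inter> space N = {x \<in> space N. \<forall>a\<in>A. P a x \<longleftrightarrow> a \<in> B}"
      using that K(1) by auto
    also have "\<dots> \<in> sets N"
    proof (rule sets.sets_Collect_finite_All[OF _ assms(1)])
      show "{x \<in> space N. P a x \<longleftrightarrow> a \<in> B} \<in> sets N" if "a \<in> A" for a
        using meas[OF that] by (cases "a \<in> B") (auto intro: sets.sets_Collect_neg)
    qed
    finally show ?thesis .
  qed
  ultimately show ?thesis
    using K(2) by (auto simp: measurable_count_space_eq2)
qed

lemma measurable_active_points:
  fixes p :: "'a \<Rightarrow> 'b::euclidean_space"
  assumes M: "finite M" "M \<noteq> {}" and p: "p \<in> borel_measurable N"
  shows "(\<lambda>x. active_points b M (p x)) \<in> measurable N (count_space (Pow M - {{}}))"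
proof -
  have k: "(\<lambda>x. finite_conjugate b M (p x)) \<in> borel_measurable N"
    using measurable_compose[OF p borel_measurable_finite_conjugate[OF M]] .
  have "(\<lambda>x. {m \<in> M. p x \<bullet> m - b m = finite_conjugate b M (p x)})
      \<in> measurable N (count_space (Pow M - {{}}))"
  proof (rule measurable_finite_subset[OF M(1)])
    show "{x \<in> space N. p x \<bullet> m - b m = finite_conjugate b M (p x)} \<in> sets N" for m
      using p k by measurable
    show "{m \<in> M. p x \<bullet> m - b m = finite_conjugate b M (p x)} \<in> Pow M - {{}}" for x
      using active_points_nonempty[OF M, of b "p x"] by (auto simp: active_points_def)
  qed auto
  then show ?thesis by (simp add: active_points_def)
qed

text \<open>
  Necessity of the first order condition. The minimizer is compared with a field \<open>v\<close> that
  selects pointwise an active point of \<open>p x\<close>, hence minimizes the linearized problem. Moving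
  from \<open>u\<close> towards \<open>v\<close> shows that \<open>u\<close> minimizes the linearized problem as well, that is, the
  integral of the gap in the Fenchel-Young inequality between \<open>u\<close> and \<open>p\<close> is not
  positive. As the gap is nonnegative pointwise, it vanishes almost everywhere.
\<close>

lemma minimizer_on_faces:
  fixes S :: "('a::euclidean_space \<Rightarrow> 'b::euclidean_space) \<Rightarrow> 'y::real_inner"
  assumes M: "finite M" "M \<noteq> {}" and \<alpha>c: "0 \<le> \<alpha>" "\<And>v. 0 \<le> c v"
    and \<Omega>: "\<Omega> \<in> lmeasurable" and S: "L2_linear \<Omega> S"
    and p: "L2_adjoint_at \<Omega> S (z - S u) p"
    and min: "L2_minimizer \<Omega> (energy \<Omega> \<alpha> c M S z) u"
  shows "AE x in lebesgue_on \<Omega>. u x \<in> convex hull (active_points (\<lambda>v. \<alpha> * c v) M (p x))"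
proof -
  let ?M = "lebesgue_on \<Omega>" and ?b = "\<lambda>v. \<alpha> * c v"
  let ?k = "finite_conjugate ?b M"
  interpret finite_measure ?M by (rule finite_measure_lebesgue_on[OF \<Omega>])
  have p_L2: "p \<in> L2 \<Omega>" using p by (simp add: L2_adjoint_at_def)
  have u: "u \<in> L2 \<Omega>" using min by (simp add: L2_minimizer_def)
  define v where "v x = (SOME m. m \<in> active_points ?b M (p x))" for x
  have v_active: "v x \<in> active_points ?b M (p x)" for x
    unfolding v_def using active_points_nonempty[OF M, of ?b "p x"] by (simp add: some_in_eq)
  have "(\<lambda>F. SOME m. m \<in> F) \<in> measurable (count_space (Pow M - {{}})) borel" by simp
  then have v_meas: "v \<in> borel_measurable ?M"
    unfolding v_def[abs_def]
    by (rule measurable_compose[OF measurable_active_points[OF M L2_measurable[OF p_L2]]])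
  obtain R where "\<And>m. m \<in> M \<Longrightarrow> norm m \<le> R"
    using finite_imp_bounded[OF M(1)] by (auto simp: bounded_iff)
  then have v: "v \<in> L2 \<Omega>"
    using v_meas v_active active_points_subset by (intro L2_bounded(1)[OF \<Omega>, of _ R]) blast+
  have v_face: "v x \<in> convex hull (active_points ?b M (p x))" for x
    using v_active by (rule hull_inc)
  have "energy \<Omega> \<alpha> c M S z u \<le> energy \<Omega> \<alpha> c M S z v"
    using min v by (simp add: L2_minimizer_def)
  also have "\<dots> < \<infinity>"
    using energy_on_faces[where c=c and S=S and z=z, OF M \<alpha>c \<Omega> p_L2 v] v_face by simp
  finally obtain G where G: "integrable ?M G" "AE x in ?M. regularizer \<alpha> c M (u x) = ereal (G x)"
    using energy_finiteE[where c=c, OF M \<alpha>c L2_measurable[OF u]] by blast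
  \<comment> \<open>By convexity, the regularizer along the segment from \<open>u\<close> to \<open>v\<close> is bounded by the
    interpolation of its values \<open>G\<close> and \<open>H\<close> at the end points.\<close>
  define H where "H x = p x \<bullet> v x - ?k (p x)" for x
  have pu: "integrable ?M (\<lambda>x. p x \<bullet> u x)" and pv: "integrable ?M (\<lambda>x. p x \<bullet> v x)"
      and k: "integrable ?M (\<lambda>x. ?k (p x))"
    using L2_integrable_inner[OF p_L2 u] L2_integrable_inner[OF p_L2 v]
      integrable_finite_conjugate[OF M \<Omega> p_L2] .
  have H: "integrable ?M H" unfolding H_def[abs_def] using pv k by simp
  have H_reg: "regularizer \<alpha> c M (v x) = ereal (H x)" for x
    unfolding H_def by (rule regularizer_eq_on_face[OF M v_face])
  let ?d = "S v - S u"
  have "0 \<le> - (?d \<bullet> (z - S u)) + ((\<integral>x. H x \<partial>?M) - (\<integral>x. G x \<partial>?M))"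
  proof (rule slope_nonneg_if_quadratic_nonneg[where B = "(norm ?d)\<^sup>2 / 2"])
    fix t :: real assume t: "0 < t" "t \<le> 1"
    let ?ut = "\<lambda>x. (1 - t) *\<^sub>R u x + t *\<^sub>R v x"
    let ?Gt = "\<lambda>x. (1 - t) * G x + t * H x"
    have ut: "?ut \<in> L2 \<Omega>" by (intro L2_add L2_scaleR u v)
    have "S ?ut = (1 - t) *\<^sub>R S u + t *\<^sub>R S v"
      using S L2_scaleR[OF u, of "1 - t"] L2_scaleR[OF v, of t] u v unfolding L2_linear_def by simp
    then have St: "S ?ut - z = t *\<^sub>R ?d - (z - S u)" by (simp add: algebra_simps)
    have le: "AE x in ?M. regularizer \<alpha> c M (?ut x) \<le> ereal (?Gt x)"
      using G(2)
    proof eventually_elim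
      case (elim x)
      then show ?case using t H_reg by (intro regularizer_convex[OF M]) auto
    qed
    have Gt: "integrable ?M ?Gt" using G(1) H by auto
    have Gt_nonneg: "AE x in ?M. 0 \<le> ?Gt x"
      using le
    proof eventually_elim
      case (elim x)
      have "0 \<le> regularizer \<alpha> c M (?ut x)" by (rule regularizer_nonneg[where c=c, OF \<alpha>c])
      from order_trans[OF this elim] show ?case by simp
    qed
    have "ennreal ((norm (S u - z))\<^sup>2 / 2 + (\<integral>x. G x \<partial>?M)) = energy \<Omega> \<alpha> c M S z u"
      by (rule energy_eq[where c=c, OF \<alpha>c G, symmetric])
    also have "\<dots> \<le> energy \<Omega> \<alpha> c M S z ?ut"
      using min ut unfolding L2_minimizer_def by blast
    also have "\<dots> \<le> ennreal ((norm (S ?ut - z))\<^sup>2 / 2) + (\<integral>\<^sup>+x. ennreal (?Gt x) \<partial>?M)"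
      unfolding energy_def
    proof (intro add_left_mono nn_integral_mono_AE)
      show "AE x in ?M. e2ennreal (regularizer \<alpha> c M (?ut x)) \<le> ennreal (?Gt x)"
        using le by eventually_elim (metis e2ennreal_mono e2ennreal_ereal)
    qed
    also have "\<dots> = ennreal ((norm (S ?ut - z))\<^sup>2 / 2 + (\<integral>x. ?Gt x \<partial>?M))"
      using nn_integral_eq_integral[OF Gt Gt_nonneg] integral_nonneg_AE[OF Gt_nonneg]
      by (simp add: ennreal_plus)
    finally have "(norm (S u - z))\<^sup>2 / 2 + (\<integral>x. G x \<partial>?M)
        \<le> (norm (S ?ut - z))\<^sup>2 / 2 + (\<integral>x. ?Gt x \<partial>?M)"
      using integral_nonneg_AE[OF Gt_nonneg] by (subst (asm) ennreal_le_iff) auto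
    moreover have "(\<integral>x. ?Gt x \<partial>?M) = (1 - t) * (\<integral>x. G x \<partial>?M) + t * (\<integral>x. H x \<partial>?M)"
      using G(1) H by simp
    moreover have "(norm (S ?ut - z))\<^sup>2
        = (norm (S u - z))\<^sup>2 - 2 * t * (?d \<bullet> (z - S u)) + t\<^sup>2 * (norm ?d)\<^sup>2"
      unfolding St power2_norm_eq_inner
      by (simp add: algebra_simps inner_diff_left inner_diff_right inner_commute power2_eq_square)
    ultimately show "0 \<le> t * (- (?d \<bullet> (z - S u)) + ((\<integral>x. H x \<partial>?M) - (\<integral>x. G x \<partial>?M)))
        + t\<^sup>2 * ((norm ?d)\<^sup>2 / 2)"
      by (simp add: algebra_simps)
  qed
  moreover have "?d \<bullet> (z - S u) = (\<integral>x. p x \<bullet> v x \<partial>?M) - (\<integral>x. p x \<bullet> u x \<partial>?M)"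
  proof -
    have "S (\<lambda>x. v x - u x) \<bullet> (z - S u) = L2_inner \<Omega> (\<lambda>x. v x - u x) p"
      using p L2_diff[OF v u] by (simp add: L2_adjoint_at_def)
    then show ?thesis
      using L2_linear_diff[OF S v u] pu pv by (simp add: L2_inner_def inner_commute inner_diff_right)
  qed
  ultimately have le0: "(\<integral>x. G x - (p x \<bullet> u x - ?k (p x)) \<partial>?M) \<le> 0"
    using pu pv k G(1) by (simp add: H_def)
  have gap: "AE x in ?M. 0 \<le> G x - (p x \<bullet> u x - ?k (p x))"
    using G(2)
  proof eventually_elim
    case (elim x)
    then show ?case using regularizer_ge[OF M, where q="p x" and v="u x" and \<alpha>=\<alpha> and c=c] by simp
  qed
  have gap_int: "integrable ?M (\<lambda>x. G x - (p x \<bullet> u x - ?k (p x)))" using pu k G(1) by simp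
  have "(\<integral>x. G x - (p x \<bullet> u x - ?k (p x)) \<partial>?M) = 0"
    using le0 integral_nonneg_AE[OF gap] by simp
  then have "AE x in ?M. G x - (p x \<bullet> u x - ?k (p x)) = 0"
    using integral_nonneg_eq_0_iff_AE[OF gap_int gap] by simp
  with G(2) show ?thesis
  proof eventually_elim
    case (elim x)
    then show ?case by (intro in_face_if_regularizer_eq[OF M]) simp
  qed
qed

section \<open>Exact rearrangements of the minimizer\<close>

text \<open>
  A subsequence that stays away from the weak limit would have a strongly convergent subsequence,
  whose limit has to be the weak limit.
\<close>

lemma weak_limit_in_compact:
  fixes y :: "nat \<Rightarrow> 'y::real_inner"
  assumes "compact K" "\<And>n. y n \<in> K" "weakly_tendsto y l"
  shows "y \<longlonglongrightarrow> l"
proof (rule ccontr)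
  assume "\<not> y \<longlonglongrightarrow> l"
  then obtain e where e: "0 < e" "\<And>N. \<exists>n\<ge>N. e \<le> dist (y n) l"
    unfolding lim_sequentially by (auto simp: not_less)
  define A where "A = {n. e \<le> dist (y n) l}"
  have "infinite A" unfolding infinite_nat_iff_unbounded_le A_def using e(2) by blast
  then obtain s :: "nat \<Rightarrow> nat" where s: "strict_mono s" "\<And>n. s n \<in> A"
    using infinite_enumerate[of A] by blast
  obtain l' r where r: "strict_mono r" "((y \<circ> s) \<circ> r) \<longlonglongrightarrow> l'"
    using assms(1,2) unfolding compact_def by (metis comp_apply)
  have "l' = l"
  proof -
    let ?f = "\<lambda>v. v \<bullet> (l' - l)"
    have "bounded_linear ?f" by (rule bounded_linear_inner_left)
    then have "(\<lambda>n. ?f (y n)) \<longlonglongrightarrow> ?f l" using assms(3) unfolding weakly_tendsto_def by blast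
    then have "((\<lambda>n. ?f (y n)) \<circ> (s \<circ> r)) \<longlonglongrightarrow> ?f l"
      using s(1) r(1) by (intro LIMSEQ_subseq_LIMSEQ strict_mono_o)
    moreover have "((\<lambda>n. ?f (y n)) \<circ> (s \<circ> r)) \<longlonglongrightarrow> ?f l'"
      using tendsto_inner[OF r(2) tendsto_const] by (simp add: o_def)
    ultimately have "?f l = ?f l'" by (rule LIMSEQ_unique)
    then have "(l' - l) \<bullet> (l' - l) = 0" by (simp add: inner_diff_left)
    then show ?thesis by simp
  qed
  moreover have "(\<lambda>n. dist (((y \<circ> s) \<circ> r) n) l) \<longlonglongrightarrow> dist l' l"
    using r(2) by (intro tendsto_intros)
  then have "e \<le> dist l' l"
    using s(2) by (rule_tac LIMSEQ_le_const) (auto simp: A_def)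
  ultimately show False using e(1) by simp
qed

text \<open>
  For a linear operator this identifies the adjoint of the derivative with the adjoint of the
  operator itself. The remainder estimate at small multiples of \<open>h\<close> is, by
  homogeneity, an estimate at \<open>h\<close>.
\<close>

lemma derivative_of_linear:
  assumes S: "L2_linear \<Omega> S" and D: "L2_has_derivative \<Omega> S D u"
    and u: "u \<in> L2 \<Omega>" and h: "h \<in> L2 \<Omega>"
  shows "D h = S h"
proof -
  have D_lin: "L2_linear \<Omega> D" using D by (simp add: L2_has_derivative_def L2_bounded_linear_def)
  have "norm (S h - D h) \<le> e" if "0 < e" for e
  proof -
    define a where "a = e / (L2_norm \<Omega> h + 1)"
    have a: "0 < a" "a * L2_norm \<Omega> h \<le> e"
      using that L2_norm_nonneg[of \<Omega> h] by (simp_all add: a_def field_simps)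
    obtain d where d: "0 < d" "\<And>k. k \<in> L2 \<Omega> \<Longrightarrow> L2_norm \<Omega> k < d \<Longrightarrow>
        norm (S (\<lambda>x. u x + k x) - S u - D k) \<le> a * L2_norm \<Omega> k"
      using D a(1) unfolding L2_has_derivative_def by blast
    define r where "r = d / (L2_norm \<Omega> h + 1)"
    have r: "0 < r" "r * L2_norm \<Omega> h < d"
      using d(1) L2_norm_nonneg[of \<Omega> h] by (simp_all add: r_def field_simps)
    let ?k = "\<lambda>x. r *\<^sub>R h x"
    have k: "?k \<in> L2 \<Omega>" by (rule L2_scaleR[OF h])
    have "S (\<lambda>x. u x + ?k x) = S u + r *\<^sub>R S h" "D ?k = r *\<^sub>R D h"
      using S D_lin u h k unfolding L2_linear_def by simp_all
    then have "norm (r *\<^sub>R (S h - D h)) \<le> a * (r * L2_norm \<Omega> h)"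
      using d(2)[OF k] r by (simp add: L2_norm_scaleR scaleR_diff_right)
    then have "r * norm (S h - D h) \<le> r * (a * L2_norm \<Omega> h)"
      using r(1) by (simp add: mult.left_commute)
    then show ?thesis using r(1) a(2) by simp
  qed
  then have "norm (S h - D h) \<le> 0" by (rule field_le_epsilon) simp
  then show ?thesis by simp
qed

text \<open>
  A cell consists of points of \<open>\<Omega>\<close> that are close to the same members of a finite net and have the
  same set of active points. The first property makes cells small. The second one makes \<open>p x\<close>
  act on differences of vectors of the common face as the constant \<open>p x0\<close> does, for any \<open>x0\<close>
  in the cell, as the envelope is affine on that face with either slope. Equal cell integrals
  therefore imply equal inner products with \<open>p\<close>, although \<open>p\<close> varies within a cell.
\<close>

lemma cellwise_rearrangement_in_faces:
  fixes p u :: "'a::euclidean_space \<Rightarrow> 'b::euclidean_space" and c :: "'b \<Rightarrow> real" and \<alpha> :: real and M :: "'b set"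
  defines "active \<equiv> \<lambda>q. active_points (\<lambda>v. \<alpha> * c v) M q"
  assumes M: "finite M" "M \<noteq> {}" and \<Omega>: "\<Omega> \<in> sets lebesgue" "bounded \<Omega>"
    and p: "p \<in> L2 \<Omega>" and u: "u \<in> L2 \<Omega>"
    and face: "AE x in lebesgue_on \<Omega>. u x \<in> convex hull (active (p x))"
    and "0 < e"
  obtains w h and K :: "('a set \<times> 'b set) set" where
    "w \<in> borel_measurable (lebesgue_on \<Omega>)" "\<And>x. x \<in> \<Omega> \<Longrightarrow> w x \<in> active (p x)"
    "finite K" "h \<in> measurable (lebesgue_on \<Omega>) (count_space K)"
    "\<And>x y. x \<in> \<Omega> \<Longrightarrow> y \<in> \<Omega> \<Longrightarrow> h x = h y \<Longrightarrow> dist x y < e"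
    "\<And>j. j \<in> K \<Longrightarrow> (LINT x:{x \<in> \<Omega>. h x = j}|lebesgue_on \<Omega>. w x)
      = (LINT x:{x \<in> \<Omega>. h x = j}|lebesgue_on \<Omega>. u x)"
    "L2_inner \<Omega> p w = L2_inner \<Omega> p u"
proof -
  let ?M = "lebesgue_on \<Omega>"
  have lm: "\<Omega> \<in> lmeasurable" using \<Omega> by (intro bounded_set_imp_lmeasurable)
  have "compact (closure \<Omega>)" using \<Omega>(2) by (simp add: compact_closure)
  then obtain Z where Z: "finite Z" "closure \<Omega> \<subseteq> (\<Union>z\<in>Z. ball z (e / 2))"
    using compactE_image[of "closure \<Omega>" "closure \<Omega>" "\<lambda>z. ball z (e / 2)"] \<open>0 < e\<close>
    by (metis (no_types, lifting) UN_I centre_in_ball half_gt_zero open_ball subsetI)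
  define near where "near x = {z \<in> Z. dist z x < e / 2}" for x
  define h where "h x = (near x, active (p x))" for x
  define K where "K = Pow Z \<times> (Pow M - {{}})"
  have K: "finite K" using Z(1) M(1) by (simp add: K_def)
  have h: "h \<in> measurable ?M (count_space K)"
  proof -
    have "near \<in> measurable ?M (count_space (Pow Z))"
      unfolding near_def[abs_def]
    proof (rule measurable_finite_subset[OF Z(1)])
      show "{x \<in> space ?M. dist z x < e / 2} \<in> sets ?M" for z
      proof -
        have "ball z (e / 2) \<inter> \<Omega> \<in> sets ?M" using \<Omega>(1) by (auto simp: sets_restrict_space_iff)
        also have "ball z (e / 2) \<inter> \<Omega> = {x \<in> space ?M. dist z x < e / 2}" by auto
        finally show ?thesis .
      qed
    qed auto
    moreover have "(\<lambda>x. active (p x)) \<in> measurable ?M (count_space (Pow M - {{}}))"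
      unfolding active_def by (rule measurable_active_points[OF M L2_measurable[OF p]])
    ultimately have "h \<in> measurable ?M (count_space (Pow Z) \<Otimes>\<^sub>M count_space (Pow M - {{}}))"
      unfolding h_def[abs_def] by (rule measurable_Pair)
    then show ?thesis
      using Z(1) M(1) by (simp add: K_def pair_measure_countable countable_finite)
  qed
  obtain w where w: "w \<in> borel_measurable ?M" "\<And>x. x \<in> \<Omega> \<Longrightarrow> w x \<in> snd (h x)"
      "\<And>j. j \<in> K \<Longrightarrow> (LINT x:{x \<in> \<Omega>. h x = j}|?M. w x) = (LINT x:{x \<in> \<Omega>. h x = j}|?M. u x)"
  proof (rule rearrangement_on_cells[OF \<Omega> h K, of snd u])
    show "finite (snd j)" "snd j \<noteq> {}" if "j \<in> K" for j
      using that finite_subset[OF _ M(1)] by (auto simp: K_def)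
    show "integrable ?M u" by (rule L2_integrable[OF lm u])
    show "AE x in ?M. u x \<in> convex hull snd (h x)" using face by (simp add: h_def)
  qed blast
  have w_active: "w x \<in> active (p x)" if "x \<in> \<Omega>" for x using w(2)[OF that] by (simp add: h_def)
  obtain R where R: "\<And>m. m \<in> M \<Longrightarrow> norm m \<le> R"
    using finite_imp_bounded[OF M(1)] by (auto simp: bounded_iff)
  have w_L2: "w \<in> L2 \<Omega>"
  proof (rule L2_bounded(1)[OF lm w(1)])
    have "norm (w x) \<le> R" if "x \<in> \<Omega>" for x
      using w_active[OF that] active_points_subset unfolding active_def by (intro R) blast
    then show "AE x in ?M. norm (w x) \<le> R" by (intro AE_I2) simp
  qed
  have pw: "integrable ?M (\<lambda>x. p x \<bullet> w x)" and pu: "integrable ?M (\<lambda>x. p x \<bullet> u x)"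
    using L2_integrable_inner[OF p w_L2] L2_integrable_inner[OF p u] .
  have D_int: "integrable ?M (\<lambda>x. w x - u x)"
    using L2_integrable[OF lm w_L2] L2_integrable[OF lm u] by (rule Bochner_Integration.integrable_diff)
  have pD: "integrable ?M (\<lambda>x. p x \<bullet> (w x - u x))" using pw pu by (simp add: inner_diff_right)
  have "(\<integral>x. p x \<bullet> (w x - u x) \<partial>?M) = (\<Sum>j\<in>K. LINT x:{x \<in> \<Omega>. h x = j}|?M. p x \<bullet> (w x - u x))"
    using integral_eq_sum_over_cells[OF h K pD] by simp
  also have "\<dots> = 0"
  proof (intro sum.neutral ballI)
    fix j assume j: "j \<in> K"
    let ?C = "{x \<in> \<Omega>. h x = j}"
    have C: "?C \<in> sets ?M" using sets_cell[OF h, of j] by simp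
    have C_int: "integrable ?M (\<lambda>x. indicator ?C x *\<^sub>R f x)" if "integrable ?M f" for f :: "'a \<Rightarrow> 'b"
      using C that by (rule integrable_mult_indicator)
    have zero: "(LINT x:?C|?M. w x - u x) = 0"
      using w(3)[OF j] C_int[OF L2_integrable[OF lm u]] C_int[OF L2_integrable[OF lm w_L2]]
      by (subst set_integral_diff) (auto simp: set_integrable_def)
    show "(LINT x:?C|?M. p x \<bullet> (w x - u x)) = 0"
    proof (cases "?C = {}")
      case True
      then show ?thesis by (simp add: set_lebesgue_integral_def)
    next
      case False
      then obtain x0 where x0: "x0 \<in> \<Omega>" "h x0 = j" by blast
      have "(LINT x:?C|?M. p x \<bullet> (w x - u x))
          = (\<integral>x. p x0 \<bullet> (indicator ?C x *\<^sub>R (w x - u x)) \<partial>?M)"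
        unfolding set_lebesgue_integral_def
      proof (rule integral_cong_AE)
        show "AE x in ?M. indicator ?C x *\<^sub>R (p x \<bullet> (w x - u x))
            = p x0 \<bullet> (indicator ?C x *\<^sub>R (w x - u x))"
          using face
        proof eventually_elim
          case (elim x)
          show ?case
          proof (cases "x \<in> ?C")
            case True
            then have same: "active (p x) = active (p x0)" using x0 by (auto simp: h_def)
            have wx: "w x \<in> convex hull (active (p x))"
              using w_active True by (intro hull_inc) auto
            note eq = regularizer_eq_on_face[OF M, of _ \<alpha> c, folded active_def]
            have "p x \<bullet> w x - p x \<bullet> u x = p x0 \<bullet> w x - p x0 \<bullet> u x"
              using eq[OF wx] eq[OF elim] eq[OF wx[unfolded same]] eq[OF elim[unfolded same]] by simp
            then show ?thesis using True by (simp add: inner_diff_right)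
          qed simp
        qed
        show "(\<lambda>x. indicator ?C x *\<^sub>R (p x \<bullet> (w x - u x))) \<in> borel_measurable ?M"
          using C pD by (intro borel_measurable_integrable integrable_mult_indicator)
        show "(\<lambda>x. p x0 \<bullet> (indicator ?C x *\<^sub>R (w x - u x))) \<in> borel_measurable ?M"
          by (rule borel_measurable_integrable[OF integrable_inner_right[OF C_int[OF D_int]]])
      qed
      also have "\<dots> = p x0 \<bullet> (LINT x:?C|?M. w x - u x)"
        unfolding set_lebesgue_integral_def by (rule integral_inner_right[OF C_int[OF D_int]])
      finally show ?thesis using zero by simp
    qed
  qed
  finally have inner_eq: "L2_inner \<Omega> p w = L2_inner \<Omega> p u"
    using pw pu by (simp add: L2_inner_def inner_diff_right)
  have diam: "dist x y < e" if xy: "x \<in> \<Omega>" "y \<in> \<Omega>" "h x = h y" for x y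
  proof -
    obtain z where z: "z \<in> Z" "dist z x < e / 2"
      using Z(2) closure_subset[of \<Omega>] xy(1) by fastforce
    then have "dist z y < e / 2" using xy(3) by (auto simp: h_def near_def)
    with z(2) show ?thesis using dist_triangle_half_r by blast
  qed
  show thesis by (rule that[OF w(1) w_active K h diam w(3) inner_eq])
qed

theorem proposition3p6:
  fixes \<Omega> :: "(real ^ 'n) set"
    and \<M> :: "(real ^ 'm) set"
    and \<alpha> :: real
    and c :: "real ^ 'm \<Rightarrow> real"
    and S :: "(real ^ 'n \<Rightarrow> real ^ 'm) \<Rightarrow> 'y::{real_inner, complete_space}"
    and S' :: "(real ^ 'n \<Rightarrow> real ^ 'm) \<Rightarrow> (real ^ 'n \<Rightarrow> real ^ 'm) \<Rightarrow> 'y"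
    and \<iota> :: "(real ^ 'n \<Rightarrow> real ^ 'm) \<Rightarrow> 'v::banach"
    and J :: "('v \<Rightarrow>\<^sub>L real) \<Rightarrow> real ^ 'n \<Rightarrow> real ^ 'm"
    and z :: 'y
    and ubar :: "real ^ 'n \<Rightarrow> real ^ 'm"
  assumes domain: "open \<Omega>" "connected \<Omega>" "bounded \<Omega>" "\<Omega> \<noteq> {}"
    and m_ge_2: "CARD('m) \<ge> 2"
    and M: "finite \<M>" "\<M> \<noteq> {}"
    and alpha: "\<alpha> > 0"
    and c: "\<And>v. c v \<ge> 0" "strictly_convex c" "lower_semicont c"
    and S_well_defined: "\<And>u v. u \<in> L2 \<Omega> \<Longrightarrow> v \<in> L2 \<Omega> \<Longrightarrow> ae_eq \<Omega> u v \<Longrightarrow> S u = S v"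
    and S_weakly_continuous:
      "\<And>us u. L2_weakly_tendsto \<Omega> us u \<Longrightarrow> weakly_tendsto (\<lambda>i. S (us i)) (S u)"
    and S_differentiable: "\<And>u. u \<in> L2 \<Omega> \<Longrightarrow> L2_has_derivative \<Omega> S (S' u) u"
    and S_compact: "L2_compact_operator \<Omega> S"
    and U_embeds_V: "L2_embedding \<Omega> \<iota>"
    and V_dual_embeds_Linfty: "Linfty_embedding \<Omega> J"
    and embeddings_compatible: "\<And>w u. u \<in> L2 \<Omega> \<Longrightarrow> blinfun_apply w (\<iota> u) = L2_inner \<Omega> (J w) u"
    and adjoint_into_V_dual: "\<And>u y. u \<in> L2 \<Omega> \<Longrightarrow> \<exists>w. L2_adjoint_at \<Omega> (S' u) y (J w)"
    and adjoint_continuous: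
      "\<And>us u y w. L2_weakly_tendsto \<Omega> us u \<Longrightarrow>
         (\<And>i. L2_adjoint_at \<Omega> (\<lambda>h. S' (us i) h - S' u h) y (J (w i))) \<Longrightarrow>
         (\<lambda>i. norm (w i)) \<longlonglongrightarrow> 0"
    and S_linear: "L2_linear \<Omega> S"
    and minimizer: "L2_minimizer \<Omega> (energy \<Omega> \<alpha> c \<M> S z) ubar"
  shows "\<exists>(zs :: nat \<Rightarrow> 'y) (us :: nat \<Rightarrow> real ^ 'n \<Rightarrow> real ^ 'm).
           zs \<longlonglongrightarrow> z \<and>
           (\<forall>k. L2_minimizer \<Omega> (energy \<Omega> \<alpha> c \<M> S (zs k)) (us k)) \<and>
           (\<forall>k. AE x in lebesgue_on \<Omega>. us k x \<in> \<M>) \<and>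
           L2_weakly_tendsto \<Omega> us ubar \<and>
           (\<forall>k. energy \<Omega> \<alpha> c \<M> S (zs k) (us k) = energy \<Omega> \<alpha> c \<M> S z ubar)"
proof -
  let ?M = "lebesgue_on \<Omega>" and ?b = "\<lambda>v. \<alpha> * c v"
  have \<Omega>: "\<Omega> \<in> sets lebesgue" using domain(1) by auto
  have lm: "\<Omega> \<in> lmeasurable" using \<Omega> domain(3) by (intro bounded_set_imp_lmeasurable)
  have alpha0: "0 \<le> \<alpha>" using alpha by simp
  have ubar: "ubar \<in> L2 \<Omega>" using minimizer by (simp add: L2_minimizer_def)
  obtain w where w: "L2_adjoint_at \<Omega> (S' ubar) (z - S ubar) (J w)"
    using adjoint_into_V_dual[OF ubar] by blast
  define p where "p = J w"
  have p: "L2_adjoint_at \<Omega> S (z - S ubar) p"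
    using w derivative_of_linear[OF S_linear S_differentiable[OF ubar] ubar]
    by (simp add: L2_adjoint_at_def p_def)
  then have p_L2: "p \<in> L2 \<Omega>" by (simp add: L2_adjoint_at_def)
  have face: "AE x in ?M. ubar x \<in> convex hull (active_points ?b \<M> (p x))"
    by (rule minimizer_on_faces[where c=c, OF M alpha0 c(1) lm S_linear p minimizer])
  define \<delta> where "\<delta> k = 1 / real (Suc k)" for k
  have \<delta>: "\<delta> \<longlonglongrightarrow> 0" "0 < \<delta> k" for k
    unfolding \<delta>_def[abs_def] using LIMSEQ_inverse_real_of_nat by (simp_all add: inverse_eq_divide)
  define admissible where
    "admissible k w h (K :: ((real ^ 'n) set \<times> (real ^ 'm) set) set) \<longleftrightarrow> w \<in> borel_measurable ?M
      \<and> (\<forall>x\<in>\<Omega>. w x \<in> active_points ?b \<M> (p x))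
      \<and> finite K \<and> h \<in> measurable ?M (count_space K)
      \<and> (\<forall>x\<in>\<Omega>. \<forall>y\<in>\<Omega>. h x = h y \<longrightarrow> dist x y < \<delta> k)
      \<and> (\<forall>j\<in>K. (LINT x:{x \<in> \<Omega>. h x = j}|?M. w x) = (LINT x:{x \<in> \<Omega>. h x = j}|?M. ubar x))
      \<and> L2_inner \<Omega> p w = L2_inner \<Omega> p ubar" for k w h K
  have "\<exists>w h K. admissible k w h K" for k
    unfolding admissible_def
    by (rule cellwise_rearrangement_in_faces[OF M \<Omega> domain(3) p_L2 ubar face \<delta>(2)[of k]]) blast
  then obtain us h K where adm: "\<And>k. admissible k (us k) (h k) (K k)"
    by metis
  have us_meas: "us k \<in> borel_measurable ?M" and
    us_active: "x \<in> \<Omega> \<Longrightarrow> us k x \<in> active_points ?b \<M> (p x)" and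
    K: "finite (K k)" and h: "h k \<in> measurable ?M (count_space (K k))" and
    diam: "x \<in> \<Omega> \<Longrightarrow> y \<in> \<Omega> \<Longrightarrow> h k x = h k y \<Longrightarrow> dist x y < \<delta> k" and
    cells: "j \<in> K k \<Longrightarrow> (LINT x:{x \<in> \<Omega>. h k x = j}|?M. us k x)
      = (LINT x:{x \<in> \<Omega>. h k x = j}|?M. ubar x)" and
    inner_eq: "L2_inner \<Omega> p (us k) = L2_inner \<Omega> p ubar" for k x y j
    using adm[of k] unfolding admissible_def by blast+
  obtain R where R: "\<And>m. m \<in> \<M> \<Longrightarrow> norm m \<le> R"
    using finite_imp_bounded[OF M(1)] by (auto simp: bounded_iff)
  have us_M: "us k x \<in> \<M>" if "x \<in> \<Omega>" for k x
    using us_active[OF that] active_points_subset by blast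
  then have us_le: "AE x in ?M. norm (us k x) \<le> R" for k
    by (intro AE_I2 R) simp
  have ubar_le: "AE x in ?M. norm (ubar x) \<le> R"
    using face
  proof eventually_elim
    case (elim x)
    have "convex hull (active_points ?b \<M> (p x)) \<subseteq> cball 0 R"
      using R active_points_subset[of ?b \<M> "p x"] by (intro hull_minimal) auto
    with elim show ?case by auto
  qed
  have us_L2: "us k \<in> L2 \<Omega>" and us_norm: "L2_norm \<Omega> (us k) \<le> sqrt (R\<^sup>2 * measure lebesgue \<Omega>)" for k
    using L2_bounded[OF lm us_meas us_le] .
  have weak: "L2_weakly_tendsto \<Omega> us ubar"
  proof (rule L2_weakly_tendsto_if_cell_integrals_eq[where h=h and K=K and \<delta>=\<delta> and R=R])
    show "bounded \<Omega>" by (rule domain(3))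
    show "ubar \<in> borel_measurable ?M" by (rule L2_measurable[OF ubar])
  qed (fact \<Omega> ubar_le us_meas us_le h K cells diam \<delta>(1))+
  have S_strong: "(\<lambda>k. S (us k)) \<longlonglongrightarrow> S ubar"
  proof (rule weak_limit_in_compact[OF _ _ S_weakly_continuous[OF weak]])
    show "compact (closure (S ` range us))"
    proof (rule S_compact[unfolded L2_compact_operator_def, rule_format])
      show "range us \<subseteq> L2 \<Omega>" using us_L2 by blast
      show "\<exists>R. \<forall>u\<in>range us. L2_norm \<Omega> u \<le> R" using us_norm by blast
    qed
    show "S (us k) \<in> closure (S ` range us)" for k
      by (intro subsetD[OF closure_subset] imageI rangeI)
  qed
  \<comment> \<open>The data are moved along with the state, so that the residual and hence the dual field \<open>p\<close>
    stay the same.\<close>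
  define zs where "zs k = z + (S (us k) - S ubar)" for k
  have residual: "zs k - S (us k) = z - S ubar" for k by (simp add: zs_def)
  have us_face: "AE x in ?M. us k x \<in> convex hull (active_points ?b \<M> (p x))" for k
    by (intro AE_I2 hull_inc us_active) simp
  have "zs \<longlonglongrightarrow> z"
    unfolding zs_def[abs_def] using S_strong
    by (auto intro!: tendsto_eq_intros)
  moreover have "L2_minimizer \<Omega> (energy \<Omega> \<alpha> c \<M> S (zs k)) (us k)" for k
    using p us_L2 us_face unfolding residual[of k, symmetric]
    by (rule minimizer_if_on_faces[where c=c, OF M alpha0 c(1) lm S_linear])
  moreover have "AE x in ?M. us k x \<in> \<M>" for k
    using us_M by (intro AE_I2) simp
  moreover have "energy \<Omega> \<alpha> c \<M> S (zs k) (us k) = energy \<Omega> \<alpha> c \<M> S z ubar" for k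
    using residual[of k]
    unfolding energy_on_faces[where c=c, OF M alpha0 c(1) lm p_L2 us_L2 us_face]
      energy_on_faces[where c=c, OF M alpha0 c(1) lm p_L2 ubar face] inner_eq
    by (simp add: norm_minus_commute)
  ultimately show ?thesis using weak by blast
qed

end
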